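(* Let $k$ be a field, let $E$ be a finite quiver and let $L$ be a finitely related left $P(E)$-module. Then $L$ contains a projective submodule $Q$ such that $L/Q$ has finite $k$-dimension.
   Context: Modules are left modules. $E=(E^0,E^1,r,s)$ is a finite quiver with source and range maps $s,r$. The path algebra $P(E)$ over $k$ has $k$-basis the set of all paths (sequences $e_1\cdots e_n$ of arrows with $r(e_t)=s(e_{t+1})$, together with a trivial path $p_i$ for each vertex $i$), with product given by concatenation (zero if not composable). A module $M$ over a ring $R$ is finitely related if there is an exact sequence $0\to K\to F\to M\to 0$ of $R$-modules with $F$ free (not necessarily of finite rank) and $K$ finitely generated. *)

theory Defs
  imports
    "HOL-Algebra.AbelCoset"
    "HOL-Algebra.Module"
    "Graph_Theory.Arc_Walk"
    "Jordan_Normal_Form.Missing_VectorSpace"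
begin

section \<open>Left modules over a ring that need not be commutative\<close>

text \<open>
  The library locale \<^locale>\<open>module\<close> demands a commutative ring of scalars.  The locale below is
  the same list of axioms over an arbitrary (unital) ring; its modules are again records of type
  \<^typ>\<open>('a, 'b) module\<close>, whose fields \<^const>\<open>mult\<close> and \<^const>\<open>one\<close> are irrelevant.
  \<open>Module.submodule\<close> and \<^const>\<open>module_hom\<close> make no commutativity assumption and are used as they
  are.  The base name \<open>submodule\<close> alone would denote a different locale, which does make it.
\<close>

locale left_module = R?: ring R + M?: abelian_group M
  for R :: "('r, 'x) ring_scheme" (structure) and M :: "('r, 'm, 'y) module_scheme" (structure) +
  assumes smult_closed [simp, intro]:
      "\<lbrakk>a \<in> carrier R; x \<in> carrier M\<rbrakk> \<Longrightarrow> a \<odot>\<^bsub>M\<^esub> x \<in> carrier M"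
    and smult_l_distr:
      "\<lbrakk>a \<in> carrier R; b \<in> carrier R; x \<in> carrier M\<rbrakk> \<Longrightarrow>
        (a \<oplus>\<^bsub>R\<^esub> b) \<odot>\<^bsub>M\<^esub> x = a \<odot>\<^bsub>M\<^esub> x \<oplus>\<^bsub>M\<^esub> b \<odot>\<^bsub>M\<^esub> x"
    and smult_r_distr:
      "\<lbrakk>a \<in> carrier R; x \<in> carrier M; y \<in> carrier M\<rbrakk> \<Longrightarrow>
        a \<odot>\<^bsub>M\<^esub> (x \<oplus>\<^bsub>M\<^esub> y) = a \<odot>\<^bsub>M\<^esub> x \<oplus>\<^bsub>M\<^esub> a \<odot>\<^bsub>M\<^esub> y"
    and smult_assoc1:
      "\<lbrakk>a \<in> carrier R; b \<in> carrier R; x \<in> carrier M\<rbrakk> \<Longrightarrow>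
        (a \<otimes>\<^bsub>R\<^esub> b) \<odot>\<^bsub>M\<^esub> x = a \<odot>\<^bsub>M\<^esub> (b \<odot>\<^bsub>M\<^esub> x)"
    and smult_one [simp]: "x \<in> carrier M \<Longrightarrow> \<one>\<^bsub>R\<^esub> \<odot>\<^bsub>M\<^esub> x = x"

definition lmod_span ::
    "('r, 'x) ring_scheme \<Rightarrow> ('r, 'm, 'y) module_scheme \<Rightarrow> 'm set \<Rightarrow> 'm set" where
  "lmod_span R M S =
    {(\<Oplus>\<^bsub>M\<^esub>v\<in>A. a v \<odot>\<^bsub>M\<^esub> v) | a A. finite A \<and> A \<subseteq> S \<and> a \<in> A \<rightarrow> carrier R}"

definition lmod_independent ::
    "('r, 'x) ring_scheme \<Rightarrow> ('r, 'm, 'y) module_scheme \<Rightarrow> 'm set \<Rightarrow> bool" where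
  "lmod_independent R M S \<longleftrightarrow>
    (\<forall>A a. finite A \<and> A \<subseteq> S \<and> a \<in> A \<rightarrow> carrier R \<and> (\<Oplus>\<^bsub>M\<^esub>v\<in>A. a v \<odot>\<^bsub>M\<^esub> v) = \<zero>\<^bsub>M\<^esub>
      \<longrightarrow> (\<forall>v\<in>A. a v = \<zero>\<^bsub>R\<^esub>))"

definition finitely_generated ::
    "('r, 'x) ring_scheme \<Rightarrow> ('r, 'm, 'y) module_scheme \<Rightarrow> bool" where
  "finitely_generated R M \<longleftrightarrow> (\<exists>S. finite S \<and> S \<subseteq> carrier M \<and> lmod_span R M S = carrier M)"

text \<open>Free of arbitrary, possibly infinite, rank: the basis is an arbitrary set.\<close>

definition free_lmod ::
    "('r, 'x) ring_scheme \<Rightarrow> ('r, 'm, 'y) module_scheme \<Rightarrow> bool" where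
  "free_lmod R M \<longleftrightarrow>
    (\<exists>B. B \<subseteq> carrier M \<and> lmod_independent R M B \<and> lmod_span R M B = carrier M)"

text \<open>Exactness of \<open>0 \<rightarrow> K \<rightarrow> F \<rightarrow> M \<rightarrow> 0\<close>, with maps \<open>i\<close> and \<open>p\<close>.\<close>

definition short_exact_lmod ::
    "('r, 'x) ring_scheme \<Rightarrow> ('r, 'a, 'u) module_scheme \<Rightarrow> ('a \<Rightarrow> 'b) \<Rightarrow>
     ('r, 'b, 'v) module_scheme \<Rightarrow> ('b \<Rightarrow> 'c) \<Rightarrow> ('r, 'c, 'w) module_scheme \<Rightarrow> bool" where
  "short_exact_lmod R K i F p M \<longleftrightarrow>
    left_module R K \<and> left_module R F \<and> left_module R M \<and>
    i \<in> module_hom R K F \<and> p \<in> module_hom R F M \<and>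
    inj_on i (carrier K) \<and>
    i ` carrier K = {x \<in> carrier F. p x = \<zero>\<^bsub>M\<^esub>} \<and>
    p ` carrier F = carrier M"

text \<open>
  HOL cannot quantify over types inside a formula, so the type \<open>'f\<close> of the elements of \<open>K\<close> and
  \<open>F\<close> is a parameter.  A theorem that assumes \<open>finitely_related TYPE('f) R M\<close> with \<open>'f\<close> a type
  variable holds for all \<open>'f\<close>, hence for every presentation, however large the rank of \<open>F\<close>.
  (One type serves for both \<open>K\<close> and \<open>F\<close>, because \<open>K\<close> may be replaced by its image in \<open>F\<close>.)
\<close>

definition finitely_related ::
    "'f itself \<Rightarrow> ('r, 'x) ring_scheme \<Rightarrow> ('r, 'm, 'y) module_scheme \<Rightarrow> bool" where
  "finitely_related _ R M \<longleftrightarrow>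
    (\<exists>(K :: ('r, 'f) module) (F :: ('r, 'f) module) i p.
      short_exact_lmod R K i F p M \<and> free_lmod R F \<and> finitely_generated R K)"

text \<open>
  The lifting property, tested on surjections \<open>N \<rightarrow> N'\<close> where \<open>N\<close> and \<open>N'\<close> have elements of type
  \<^typ>\<open>'m \<Rightarrow> 'r\<close> and \<^typ>\<open>'m\<close>.  The lemma \<open>projective_lmod_lift\<close> below shows that this bound on the
  types is no restriction: the property then holds for surjections between modules of any types.
\<close>

definition projective_lmod ::
    "('r, 'x) ring_scheme \<Rightarrow> ('r, 'm, 'y) module_scheme \<Rightarrow> bool" where
  "projective_lmod R P \<longleftrightarrow> left_module R P \<and>
    (\<forall>(N :: ('r, 'm \<Rightarrow> 'r) module) (N' :: ('r, 'm) module) g f.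
      left_module R N \<and> left_module R N' \<and>
      g \<in> module_hom R N N' \<and> g ` carrier N = carrier N' \<and> f \<in> module_hom R P N'
      \<longrightarrow> (\<exists>h \<in> module_hom R P N. \<forall>x\<in>carrier P. g (h x) = f x))"

context left_module
begin

lemma smult_l_null: "x \<in> carrier M \<Longrightarrow> \<zero>\<^bsub>R\<^esub> \<odot>\<^bsub>M\<^esub> x = \<zero>\<^bsub>M\<^esub>"
proof -
  assume x: "x \<in> carrier M"
  have "\<zero>\<^bsub>R\<^esub> \<odot>\<^bsub>M\<^esub> x \<oplus>\<^bsub>M\<^esub> \<zero>\<^bsub>R\<^esub> \<odot>\<^bsub>M\<^esub> x = \<zero>\<^bsub>R\<^esub> \<odot>\<^bsub>M\<^esub> x"
    using smult_l_distr[of "\<zero>\<^bsub>R\<^esub>" "\<zero>\<^bsub>R\<^esub>" x] x by simp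
  then show ?thesis using x by (metis M.add.r_cancel_one' R.zero_closed smult_closed)
qed

lemma smult_r_null: "a \<in> carrier R \<Longrightarrow> a \<odot>\<^bsub>M\<^esub> \<zero>\<^bsub>M\<^esub> = \<zero>\<^bsub>M\<^esub>"
proof -
  assume a: "a \<in> carrier R"
  have "a \<odot>\<^bsub>M\<^esub> \<zero>\<^bsub>M\<^esub> \<oplus>\<^bsub>M\<^esub> a \<odot>\<^bsub>M\<^esub> \<zero>\<^bsub>M\<^esub> = a \<odot>\<^bsub>M\<^esub> \<zero>\<^bsub>M\<^esub>"
    using smult_r_distr[of a "\<zero>\<^bsub>M\<^esub>" "\<zero>\<^bsub>M\<^esub>"] a by simp
  then show ?thesis using a by (metis M.add.r_cancel_one' M.zero_closed smult_closed)
qed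

lemma finsum_smult:
  "\<lbrakk>finite A; a \<in> carrier R; u \<in> A \<rightarrow> carrier M\<rbrakk> \<Longrightarrow>
    a \<odot>\<^bsub>M\<^esub> (\<Oplus>\<^bsub>M\<^esub>v\<in>A. u v) = (\<Oplus>\<^bsub>M\<^esub>v\<in>A. a \<odot>\<^bsub>M\<^esub> u v)"
proof (induct set: finite)
  case empty then show ?case by (simp add: smult_r_null)
next
  case (insert x F) then show ?case by (simp add: Pi_def smult_r_distr)
qed

end

lemma left_module_hom_zero:
  assumes "left_module R M" "left_module R N" "g \<in> module_hom R M N"
  shows "g \<zero>\<^bsub>M\<^esub> = \<zero>\<^bsub>N\<^esub>"
proof -
  interpret M: left_module R M by fact
  interpret N: left_module R N by fact
  have "g (\<zero>\<^bsub>R\<^esub> \<odot>\<^bsub>M\<^esub> \<zero>\<^bsub>M\<^esub>) = \<zero>\<^bsub>R\<^esub> \<odot>\<^bsub>N\<^esub> g \<zero>\<^bsub>M\<^esub>"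
    using assms(3) by (simp add: module_hom_smult)
  moreover have "g \<zero>\<^bsub>M\<^esub> \<in> carrier N" using module_hom_closed[OF assms(3)] by auto
  ultimately show ?thesis by (simp add: M.smult_l_null N.smult_l_null)
qed

lemma left_module_hom_finsum:
  assumes "left_module R M" "left_module R N" "g \<in> module_hom R M N"
    and "finite A" "u \<in> A \<rightarrow> carrier M"
  shows "g (\<Oplus>\<^bsub>M\<^esub>v\<in>A. u v) = (\<Oplus>\<^bsub>N\<^esub>v\<in>A. g (u v))"
proof -
  interpret M: left_module R M by fact
  interpret N: left_module R N by fact
  have g: "\<And>x. x \<in> carrier M \<Longrightarrow> g x \<in> carrier N"
    using module_hom_closed[OF assms(3)] by auto
  show ?thesis using assms(4,5)
  proof (induct set: finite)
    case empty then show ?case by (simp add: left_module_hom_zero[OF assms(1-3)])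
  next
    case (insert x F)
    have "g (u x \<oplus>\<^bsub>M\<^esub> finsum M u F) = g (u x) \<oplus>\<^bsub>N\<^esub> g (finsum M u F)"
      using insert by (intro module_hom_add[OF assms(3)]) (auto simp: Pi_def)
    then show ?case using insert g by (simp add: Pi_def)
  qed
qed

text \<open>
  The free module on \<open>I\<close>, as finitely supported functions, and the extension of a map \<open>u\<close> on \<open>I\<close> to a
  linear map on it.
\<close>

definition finsupp_lmod :: "('r, 'x) ring_scheme \<Rightarrow> 'i set \<Rightarrow> ('r, 'i \<Rightarrow> 'r) module" where
  "finsupp_lmod R I =
    \<lparr>carrier = {c. (\<forall>i. c i \<in> carrier R) \<and> (\<forall>i. i \<notin> I \<longrightarrow> c i = \<zero>\<^bsub>R\<^esub>) \<and> finite {i. c i \<noteq> \<zero>\<^bsub>R\<^esub>}},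
     mult = undefined, one = undefined, zero = (\<lambda>i. \<zero>\<^bsub>R\<^esub>),
     add = (\<lambda>c d i. c i \<oplus>\<^bsub>R\<^esub> d i), smult = (\<lambda>a c i. a \<otimes>\<^bsub>R\<^esub> c i)\<rparr>"

lemma left_module_finsupp:
  assumes "ring R" shows "left_module R (finsupp_lmod R I)"
proof -
  interpret R: ring R by fact
  let ?F = "finsupp_lmod R I"
  have add: "(\<lambda>i. c i \<oplus>\<^bsub>R\<^esub> d i) \<in> carrier ?F" if "c \<in> carrier ?F" "d \<in> carrier ?F" for c d
  proof -
    have "{i. c i \<oplus>\<^bsub>R\<^esub> d i \<noteq> \<zero>\<^bsub>R\<^esub>} \<subseteq> {i. c i \<noteq> \<zero>\<^bsub>R\<^esub>} \<union> {i. d i \<noteq> \<zero>\<^bsub>R\<^esub>}" by auto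
    then show ?thesis using that by (auto simp: finsupp_lmod_def intro: finite_subset)
  qed
  have neg: "(\<lambda>i. \<ominus>\<^bsub>R\<^esub> c i) \<in> carrier ?F" if "c \<in> carrier ?F" for c
  proof -
    have "{i. \<ominus>\<^bsub>R\<^esub> c i \<noteq> \<zero>\<^bsub>R\<^esub>} \<subseteq> {i. c i \<noteq> \<zero>\<^bsub>R\<^esub>}" by auto
    then show ?thesis using that by (auto simp: finsupp_lmod_def intro: finite_subset)
  qed
  have smult: "(\<lambda>i. a \<otimes>\<^bsub>R\<^esub> c i) \<in> carrier ?F" if "a \<in> carrier R" "c \<in> carrier ?F" for a c
  proof -
    have "{i. a \<otimes>\<^bsub>R\<^esub> c i \<noteq> \<zero>\<^bsub>R\<^esub>} \<subseteq> {i. c i \<noteq> \<zero>\<^bsub>R\<^esub>}" using that(1) by auto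
    then show ?thesis using that by (auto simp: finsupp_lmod_def intro: finite_subset)
  qed
  have ag: "abelian_group ?F"
  proof (rule abelian_groupI)
    fix c assume c: "c \<in> carrier ?F"
    show "\<exists>d\<in>carrier ?F. d \<oplus>\<^bsub>?F\<^esub> c = \<zero>\<^bsub>?F\<^esub>"
      using c by (intro bexI[OF _ neg[OF c]]) (auto simp: finsupp_lmod_def R.l_neg)
  qed (use add in \<open>auto simp: finsupp_lmod_def R.a_ac\<close>)
  interpret F: abelian_group ?F by (fact ag)
  show ?thesis
  proof unfold_locales
    show "a \<odot>\<^bsub>?F\<^esub> c \<in> carrier ?F" if "a \<in> carrier R" "c \<in> carrier ?F" for a c
      using smult[OF that] by (simp add: finsupp_lmod_def)
  qed (auto simp: finsupp_lmod_def R.l_distr R.r_distr R.m_assoc)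
qed

definition lin_ext :: "('r, 'x) ring_scheme \<Rightarrow> ('r, 'n, 'y) module_scheme \<Rightarrow> ('i \<Rightarrow> 'n) \<Rightarrow>
    ('i \<Rightarrow> 'r) \<Rightarrow> 'n" where
  "lin_ext R N u c = (\<Oplus>\<^bsub>N\<^esub>i\<in>{i. c i \<noteq> \<zero>\<^bsub>R\<^esub>}. c i \<odot>\<^bsub>N\<^esub> u i)"

lemma lin_ext_eq:
  assumes "left_module R N" "c \<in> carrier (finsupp_lmod R I)" "u \<in> I \<rightarrow> carrier N"
    and "finite A" "A \<subseteq> I" "{i. c i \<noteq> \<zero>\<^bsub>R\<^esub>} \<subseteq> A"
  shows "lin_ext R N u c = (\<Oplus>\<^bsub>N\<^esub>i\<in>A. c i \<odot>\<^bsub>N\<^esub> u i)"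
proof -
  interpret N: left_module R N by fact
  show ?thesis unfolding lin_ext_def
    using assms(2-6)
    by (intro N.add.finprod_mono_neutral_cong_left)
       (auto simp: N.smult_l_null finsupp_lmod_def Pi_def subset_iff)
qed

lemma lin_ext_hom:
  assumes N: "left_module R N" and u: "u \<in> I \<rightarrow> carrier N"
  shows "lin_ext R N u \<in> module_hom R (finsupp_lmod R I) N"
proof -
  interpret N: left_module R N by fact
  let ?F = "finsupp_lmod R I"
  interpret F: left_module R ?F by (rule left_module_finsupp) (rule N.R.ring_axioms)
  have supp: "finite {i. c i \<noteq> \<zero>\<^bsub>R\<^esub>}" "{i. c i \<noteq> \<zero>\<^bsub>R\<^esub>} \<subseteq> I" "\<And>i. c i \<in> carrier R"
    if "c \<in> carrier ?F" for c
    using that by (auto simp: finsupp_lmod_def)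
  have uc: "u i \<in> carrier N" if "i \<in> I" for i using u that by auto
  have closed: "lin_ext R N u c \<in> carrier N" if "c \<in> carrier ?F" for c
    unfolding lin_ext_def using supp[OF that] uc by (intro N.finsum_closed) auto
  have add: "lin_ext R N u (c \<oplus>\<^bsub>?F\<^esub> d) = lin_ext R N u c \<oplus>\<^bsub>N\<^esub> lin_ext R N u d"
    if c: "c \<in> carrier ?F" and d: "d \<in> carrier ?F" for c d
  proof -
    let ?A = "{i. c i \<noteq> \<zero>\<^bsub>R\<^esub>} \<union> {i. d i \<noteq> \<zero>\<^bsub>R\<^esub>}"
    have A: "finite ?A" "?A \<subseteq> I" using supp[OF c] supp[OF d] by auto
    have cd: "c \<oplus>\<^bsub>?F\<^esub> d \<in> carrier ?F" using c d by simp
    have pt: "(c \<oplus>\<^bsub>?F\<^esub> d) i = c i \<oplus>\<^bsub>R\<^esub> d i" for i by (simp add: finsupp_lmod_def)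
    have "lin_ext R N u (c \<oplus>\<^bsub>?F\<^esub> d) = (\<Oplus>\<^bsub>N\<^esub>i\<in>?A. (c \<oplus>\<^bsub>?F\<^esub> d) i \<odot>\<^bsub>N\<^esub> u i)"
      by (rule lin_ext_eq[OF N cd u A]) (auto simp: pt)
    also have "\<dots> = (\<Oplus>\<^bsub>N\<^esub>i\<in>?A. c i \<odot>\<^bsub>N\<^esub> u i \<oplus>\<^bsub>N\<^esub> d i \<odot>\<^bsub>N\<^esub> u i)"
      using supp[OF c] supp[OF d] uc A
      by (intro N.add.finprod_cong') (auto simp: pt N.smult_l_distr)
    also have "\<dots> = (\<Oplus>\<^bsub>N\<^esub>i\<in>?A. c i \<odot>\<^bsub>N\<^esub> u i) \<oplus>\<^bsub>N\<^esub> (\<Oplus>\<^bsub>N\<^esub>i\<in>?A. d i \<odot>\<^bsub>N\<^esub> u i)"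
      using supp[OF c] supp[OF d] uc A by (intro N.finsum_addf) auto
    also have "(\<Oplus>\<^bsub>N\<^esub>i\<in>?A. c i \<odot>\<^bsub>N\<^esub> u i) = lin_ext R N u c"
      by (rule lin_ext_eq[OF N c u A, symmetric]) auto
    also have "(\<Oplus>\<^bsub>N\<^esub>i\<in>?A. d i \<odot>\<^bsub>N\<^esub> u i) = lin_ext R N u d"
      by (rule lin_ext_eq[OF N d u A, symmetric]) auto
    finally show ?thesis .
  qed
  have smult: "lin_ext R N u (a \<odot>\<^bsub>?F\<^esub> c) = a \<odot>\<^bsub>N\<^esub> lin_ext R N u c"
    if a: "a \<in> carrier R" and c: "c \<in> carrier ?F" for a c
  proof -
    let ?A = "{i. c i \<noteq> \<zero>\<^bsub>R\<^esub>}"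
    have A: "finite ?A" "?A \<subseteq> I" using supp[OF c] by auto
    have ac: "a \<odot>\<^bsub>?F\<^esub> c \<in> carrier ?F" using a c by simp
    have pt: "(a \<odot>\<^bsub>?F\<^esub> c) i = a \<otimes>\<^bsub>R\<^esub> c i" for i by (simp add: finsupp_lmod_def)
    have "lin_ext R N u (a \<odot>\<^bsub>?F\<^esub> c) = (\<Oplus>\<^bsub>N\<^esub>i\<in>?A. (a \<odot>\<^bsub>?F\<^esub> c) i \<odot>\<^bsub>N\<^esub> u i)"
      by (rule lin_ext_eq[OF N ac u A]) (use a in \<open>auto simp: pt\<close>)
    also have "\<dots> = (\<Oplus>\<^bsub>N\<^esub>i\<in>?A. a \<odot>\<^bsub>N\<^esub> (c i \<odot>\<^bsub>N\<^esub> u i))"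
      using supp[OF c] uc A a by (intro N.add.finprod_cong') (auto simp: pt N.smult_assoc1)
    also have "\<dots> = a \<odot>\<^bsub>N\<^esub> lin_ext R N u c"
      unfolding lin_ext_def using supp[OF c] uc A a by (intro N.finsum_smult[symmetric]) auto
    finally show ?thesis .
  qed
  show ?thesis unfolding module_hom_def using closed add smult by auto
qed

lemma lin_ext_single:
  assumes N: "left_module R N" and u: "u \<in> I \<rightarrow> carrier N" and i: "i \<in> I"
  shows "(\<lambda>j. if j = i then \<one>\<^bsub>R\<^esub> else \<zero>\<^bsub>R\<^esub>) \<in> carrier (finsupp_lmod R I)"
    and "lin_ext R N u (\<lambda>j. if j = i then \<one>\<^bsub>R\<^esub> else \<zero>\<^bsub>R\<^esub>) = u i"
proof -
  interpret N: left_module R N by fact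
  let ?e = "\<lambda>j. if j = i then \<one>\<^bsub>R\<^esub> else \<zero>\<^bsub>R\<^esub>"
  have "{j. ?e j \<noteq> \<zero>\<^bsub>R\<^esub>} \<subseteq> {i}" by auto
  then show e: "?e \<in> carrier (finsupp_lmod R I)"
    using i by (auto simp: finsupp_lmod_def intro: finite_subset)
  have ui: "u i \<in> carrier N" using u i by auto
  have "lin_ext R N u ?e = (\<Oplus>\<^bsub>N\<^esub>j\<in>{i}. ?e j \<odot>\<^bsub>N\<^esub> u j)"
    by (rule lin_ext_eq[OF N e u]) (use i in auto)
  also have "\<dots> = u i" using ui by simp
  finally show "lin_ext R N u ?e = u i" .
qed

lemma projective_lmod_lift:
  fixes P :: "('r, 'm, 'y) module_scheme"
    and N :: "('r, 'n, 'z) module_scheme" and N' :: "('r, 'p, 'w) module_scheme"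
  assumes P: "projective_lmod R P" and N: "left_module R N" and N': "left_module R N'"
    and g: "g \<in> module_hom R N N'" and surj: "g ` carrier N = carrier N'"
    and f: "f \<in> module_hom R P N'"
  shows "\<exists>h \<in> module_hom R P N. \<forall>x\<in>carrier P. g (h x) = f x"
proof -
  interpret P: left_module R P using P by (simp add: projective_lmod_def)
  let ?I = "carrier P"
  let ?F = "finsupp_lmod R ?I"
  let ?P = "\<lparr>carrier = carrier P, mult = mult P, one = one P, zero = zero P, add = add P,
             smult = smult P\<rparr>"
  have F: "left_module R ?F" by (rule left_module_finsupp) (rule P.R.ring_axioms)
  have P': "left_module R ?P"
  proof -
    have "abelian_group ?P"
      by (rule abelian_groupI) (auto simp: P.a_ac intro: P.l_neg P.a_inv_closed)
    then interpret Q: abelian_group ?P .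
    show ?thesis
      by unfold_locales (auto simp: P.smult_l_distr P.smult_r_distr P.smult_assoc1)
  qed
  have id: "(\<lambda>x. x) \<in> carrier P \<rightarrow> carrier ?P" by simp
  have pi: "lin_ext R ?P (\<lambda>x. x) \<in> module_hom R ?F ?P" by (rule lin_ext_hom[OF P' id])
  have pi_surj: "lin_ext R ?P (\<lambda>x. x) ` carrier ?F = carrier ?P"
  proof
    show "lin_ext R ?P (\<lambda>x. x) ` carrier ?F \<subseteq> carrier ?P"
      using module_hom_closed[OF pi] by auto
    show "carrier ?P \<subseteq> lin_ext R ?P (\<lambda>x. x) ` carrier ?F"
    proof
      fix x assume "x \<in> carrier ?P"
      then have x: "x \<in> carrier P" by simp
      show "x \<in> lin_ext R ?P (\<lambda>x. x) ` carrier ?F"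
        using lin_ext_single[OF P' id x] by (metis (no_types, lifting) image_eqI)
    qed
  qed
  have idhom: "(\<lambda>x. x) \<in> module_hom R P ?P" by (auto simp: module_hom_def)
  obtain s where s: "s \<in> module_hom R P ?F"
    and ps: "\<And>x. x \<in> carrier P \<Longrightarrow> lin_ext R ?P (\<lambda>x. x) (s x) = x"
  proof -
    have "\<exists>s \<in> module_hom R P ?F. \<forall>x\<in>carrier P. lin_ext R ?P (\<lambda>x. x) (s x) = x"
      using P F P' pi pi_surj idhom unfolding projective_lmod_def by (elim conjE allE impE) blast+
    then show thesis using that by blast
  qed
  have fc: "f x \<in> carrier N'" if "x \<in> carrier P" for x
    using module_hom_closed[OF f] that by auto
  have "\<forall>x. \<exists>n. x \<in> carrier P \<longrightarrow> n \<in> carrier N \<and> g n = f x"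
    using fc surj by (metis (no_types, lifting) imageE)
  then obtain u where u: "\<And>x. x \<in> carrier P \<Longrightarrow> u x \<in> carrier N \<and> g (u x) = f x" by metis
  have uN: "u \<in> ?I \<rightarrow> carrier N" using u by auto
  have ext: "lin_ext R N u \<in> module_hom R ?F N" by (rule lin_ext_hom[OF N uN])
  have comm: "g (lin_ext R N u c) = f (lin_ext R ?P (\<lambda>x. x) c)" if c: "c \<in> carrier ?F" for c
  proof -
    let ?A = "{i. c i \<noteq> \<zero>\<^bsub>R\<^esub>}"
    interpret N: left_module R N by (fact N)
    interpret N': left_module R N' by (fact N')
    have A: "finite ?A" "?A \<subseteq> carrier P" "\<And>i. c i \<in> carrier R"
      using c by (auto simp: finsupp_lmod_def)
    have "g (lin_ext R N u c) = (\<Oplus>\<^bsub>N'\<^esub>i\<in>?A. g (c i \<odot>\<^bsub>N\<^esub> u i))"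
      unfolding lin_ext_def
      by (rule left_module_hom_finsum[OF N N' g A(1)]) (use A u in auto)
    also have "\<dots> = (\<Oplus>\<^bsub>N'\<^esub>i\<in>?A. f (c i \<odot>\<^bsub>P\<^esub> i))"
    proof (intro N'.add.finprod_cong' refl)
      show "(\<lambda>i. f (c i \<odot>\<^bsub>P\<^esub> i)) \<in> ?A \<rightarrow> carrier N'" using A fc by auto
      fix i assume i: "i \<in> ?A"
      then have iP: "i \<in> carrier P" using A by auto
      show "g (c i \<odot>\<^bsub>N\<^esub> u i) = f (c i \<odot>\<^bsub>P\<^esub> i)"
        using module_hom_smult[OF g A(3)] module_hom_smult[OF f A(3) iP] u[OF iP] by simp
    qed
    also have "\<dots> = f (\<Oplus>\<^bsub>P\<^esub>i\<in>?A. c i \<odot>\<^bsub>P\<^esub> i)"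
      by (rule left_module_hom_finsum[OF P.left_module_axioms N' f A(1), symmetric])
         (use A in auto)
    also have "(\<Oplus>\<^bsub>P\<^esub>i\<in>?A. c i \<odot>\<^bsub>P\<^esub> i) = lin_ext R ?P (\<lambda>x. x) c"
      by (simp add: lin_ext_def finsum_def finprod_def)
    finally show ?thesis .
  qed
  have sF: "s x \<in> carrier ?F" if "x \<in> carrier P" for x
    using module_hom_closed[OF s] that by auto
  let ?h = "\<lambda>x. lin_ext R N u (s x)"
  have "?h \<in> module_hom R P N"
    unfolding module_hom_def
    using sF module_hom_closed[OF ext]
    by (auto simp: module_hom_add[OF s] module_hom_add[OF ext]
          module_hom_smult[OF s] module_hom_smult[OF ext])
  moreover have "\<forall>x\<in>carrier P. g (?h x) = f x" using comm sF ps by simp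
  ultimately show ?thesis by (intro bexI[of _ ?h])
qed

definition quotient_lmod :: "('r, 'm, 'y) module_scheme \<Rightarrow> 'm set \<Rightarrow> ('r, 'm set) module" where
  "quotient_lmod M Q =
    \<lparr>carrier = a_rcosets\<^bsub>M\<^esub> Q, mult = undefined, one = undefined,
     zero = Q, add = (<+>\<^bsub>M\<^esub>), smult = (\<lambda>a X. \<Union>x\<in>X. Q +>\<^bsub>M\<^esub> (a \<odot>\<^bsub>M\<^esub> x))\<rparr>"

lemma (in left_module) quotient_lmod:
  assumes "Module.submodule Q R M"
  shows "left_module R (quotient_lmod M Q)"
    and "\<And>a x. \<lbrakk>a \<in> carrier R; x \<in> carrier M\<rbrakk> \<Longrightarrow>
      a \<odot>\<^bsub>quotient_lmod M Q\<^esub> (Q +>\<^bsub>M\<^esub> x) = Q +>\<^bsub>M\<^esub> (a \<odot>\<^bsub>M\<^esub> x)"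
proof -
  interpret Q: Module.submodule Q R M by fact
  interpret Q: abelian_subgroup Q M
    using Q.subgroup_axioms M.abelian_group_axioms
    by (intro abelian_subgroupI3) (auto intro: additive_subgroup.intro)
  let ?Q = "quotient_lmod M Q"
  have carr: "carrier ?Q = (\<lambda>x. Q +>\<^bsub>M\<^esub> x) ` carrier M"
    by (auto simp: quotient_lmod_def A_RCOSETS_def')
  have add: "(Q +>\<^bsub>M\<^esub> x) \<oplus>\<^bsub>?Q\<^esub> (Q +>\<^bsub>M\<^esub> y) = Q +>\<^bsub>M\<^esub> (x \<oplus>\<^bsub>M\<^esub> y)"
    if "x \<in> carrier M" "y \<in> carrier M" for x y
    using that by (simp add: quotient_lmod_def Q.a_rcos_sum)
  have zero: "\<zero>\<^bsub>?Q\<^esub> = Q +>\<^bsub>M\<^esub> \<zero>\<^bsub>M\<^esub>"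
    by (simp add: quotient_lmod_def Q.a_subset)
  have smult: "a \<odot>\<^bsub>?Q\<^esub> (Q +>\<^bsub>M\<^esub> x) = Q +>\<^bsub>M\<^esub> (a \<odot>\<^bsub>M\<^esub> x)"
    if a: "a \<in> carrier R" and x: "x \<in> carrier M" for a x
  proof -
    have "Q +>\<^bsub>M\<^esub> (a \<odot>\<^bsub>M\<^esub> y) = Q +>\<^bsub>M\<^esub> (a \<odot>\<^bsub>M\<^esub> x)" if y: "y \<in> Q +>\<^bsub>M\<^esub> x" for y
    proof -
      obtain q where q: "q \<in> Q" "y = q \<oplus>\<^bsub>M\<^esub> x" using y by (auto simp: a_r_coset_def')
      then have "q \<in> carrier M" using Q.a_subset by auto
      then have "a \<odot>\<^bsub>M\<^esub> y = a \<odot>\<^bsub>M\<^esub> q \<oplus>\<^bsub>M\<^esub> a \<odot>\<^bsub>M\<^esub> x"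
        using a x q by (simp add: smult_r_distr)
      then have "a \<odot>\<^bsub>M\<^esub> y \<in> Q +>\<^bsub>M\<^esub> (a \<odot>\<^bsub>M\<^esub> x)"
        using a q by (auto simp: a_r_coset_def')
      then show ?thesis using a x by (metis Q.a_repr_independence' smult_closed)
    qed
    moreover have "x \<in> Q +>\<^bsub>M\<^esub> x" using x by (rule Q.a_rcos_self)
    ultimately have "(\<Union>y\<in>Q +>\<^bsub>M\<^esub> x. Q +>\<^bsub>M\<^esub> (a \<odot>\<^bsub>M\<^esub> y)) = Q +>\<^bsub>M\<^esub> (a \<odot>\<^bsub>M\<^esub> x)"
      by (rule UN_constant_eq[rotated, OF ballI])
    then show ?thesis by (simp add: quotient_lmod_def)
  qed
  have ag: "abelian_group ?Q"
  proof (rule abelian_groupI)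
    fix X assume "X \<in> carrier ?Q"
    then obtain x where x: "x \<in> carrier M" "X = Q +>\<^bsub>M\<^esub> x" by (auto simp: carr)
    show "\<exists>Y\<in>carrier ?Q. Y \<oplus>\<^bsub>?Q\<^esub> X = \<zero>\<^bsub>?Q\<^esub>"
      using x by (intro bexI[of _ "Q +>\<^bsub>M\<^esub> (\<ominus>\<^bsub>M\<^esub> x)"]) (auto simp: carr add zero M.l_neg)
  qed (auto simp: carr add zero M.a_ac)
  interpret A: abelian_group ?Q by (fact ag)
  show "left_module R ?Q"
    by unfold_locales
       (auto simp: carr add smult smult_l_distr smult_r_distr smult_assoc1)
  show "\<And>a x. \<lbrakk>a \<in> carrier R; x \<in> carrier M\<rbrakk> \<Longrightarrow>
      a \<odot>\<^bsub>?Q\<^esub> (Q +>\<^bsub>M\<^esub> x) = Q +>\<^bsub>M\<^esub> (a \<odot>\<^bsub>M\<^esub> x)" by (fact smult)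
qed

text \<open>
  If \<open>A\<close> is a \<open>K\<close>-algebra, every left \<open>A\<close>-module is a \<open>K\<close>-module through \<open>c \<mapsto> c 1\<^sub>A\<close>.
\<close>

definition restrict_scalars ::
    "('k, 'a, 'x) module_scheme \<Rightarrow> ('a, 'm, 'y) module_scheme \<Rightarrow> ('k, 'm) module" where
  "restrict_scalars A M =
    \<lparr>carrier = carrier M, mult = mult M, one = one M, zero = zero M, add = add M,
     smult = (\<lambda>c x. (c \<odot>\<^bsub>A\<^esub> \<one>\<^bsub>A\<^esub>) \<odot>\<^bsub>M\<^esub> x)\<rparr>"

definition finite_dimensional ::
    "('k, 'x) ring_scheme \<Rightarrow> ('k, 'v, 'y) module_scheme \<Rightarrow> bool" where
  "finite_dimensional K V \<longleftrightarrow> vectorspace K V \<and> vectorspace.fin_dim K V"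


section \<open>The path algebra of a quiver\<close>

text \<open>
  A quiver is a \<^typ>\<open>('v, 'e) pre_digraph\<close>, with \<^const>\<open>tail\<close> as source and \<^const>\<open>head\<close> as
  range; loops and parallel arrows are allowed, and \<^locale>\<open>fin_digraph\<close> makes it finite.  A path is
  a pair of its source vertex and its list of arrows, so that \<open>(v, [])\<close> is the trivial path at \<open>v\<close>.
\<close>

definition paths :: "('v, 'e) pre_digraph \<Rightarrow> ('v \<times> 'e list) set" where
  "paths E = {(u, p). \<exists>v. pre_digraph.awalk E u p v}"

definition path_range :: "('v, 'e) pre_digraph \<Rightarrow> 'v \<times> 'e list \<Rightarrow> 'v" where
  "path_range E x = last (pre_digraph.awalk_verts E (fst x) (snd x))"

definition path_factorizations ::
    "('v, 'e) pre_digraph \<Rightarrow> 'v \<times> 'e list \<Rightarrow> (('v \<times> 'e list) \<times> ('v \<times> 'e list)) set" where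
  "path_factorizations E x =
    {(y, z). y \<in> paths E \<and> z \<in> paths E \<and> path_range E y = fst z \<and> x = (fst y, snd y @ snd z)}"

text \<open>
  The element \<open>\<Sum>\<^sub>x f x \<cdot> x\<close> is represented by its coefficient function \<open>f\<close>, of finite support and
  vanishing on pairs that are not paths.  The product is the bilinear extension of concatenation:
  the coefficient of \<open>x\<close> in \<open>f g\<close> collects the pairs \<open>(y, z)\<close> of paths with concatenation \<open>x\<close>.
\<close>

definition path_algebra ::
    "('k, 'x) ring_scheme \<Rightarrow> ('v, 'e) pre_digraph \<Rightarrow> ('k, 'v \<times> 'e list \<Rightarrow> 'k) module" where
  "path_algebra K E =
    \<lparr>carrier = {f. (\<forall>x. f x \<in> carrier K) \<and> (\<forall>x. x \<notin> paths E \<longrightarrow> f x = \<zero>\<^bsub>K\<^esub>) \<and>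
                 finite {x. f x \<noteq> \<zero>\<^bsub>K\<^esub>}},
     mult = (\<lambda>f g x. \<Oplus>\<^bsub>K\<^esub>yz\<in>path_factorizations E x. f (fst yz) \<otimes>\<^bsub>K\<^esub> g (snd yz)),
     one = (\<lambda>x. if fst x \<in> verts E \<and> snd x = [] then \<one>\<^bsub>K\<^esub> else \<zero>\<^bsub>K\<^esub>),
     zero = (\<lambda>x. \<zero>\<^bsub>K\<^esub>),
     add = (\<lambda>f g x. f x \<oplus>\<^bsub>K\<^esub> g x),
     smult = (\<lambda>c f x. c \<otimes>\<^bsub>K\<^esub> f x)\<rparr>"

lemma (in comm_monoid) finprod_Sigma:
  assumes "finite A" "\<And>x. x \<in> A \<Longrightarrow> finite (B x)" "f \<in> Sigma A B \<rightarrow> carrier G"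
  shows "finprod G (\<lambda>x. finprod G (\<lambda>y. f (x, y)) (B x)) A = finprod G f (Sigma A B)"
proof -
  have S: "Sigma A B = (\<Union>x\<in>A. Pair x ` B x)" by auto
  have "finprod G f (Sigma A B) = finprod G (\<lambda>x. finprod G f (Pair x ` B x)) A"
    unfolding S using assms by (intro finprod_UN_disjoint) (auto simp: pairwise_def disjnt_def)
  also have "\<dots> = finprod G (\<lambda>x. finprod G (\<lambda>y. f (x, y)) (B x)) A"
  proof (intro finprod_cong' refl)
    fix x assume x: "x \<in> A"
    show "finprod G f (Pair x ` B x) = finprod G (\<lambda>y. f (x, y)) (B x)"
      using assms(3) x by (intro finprod_reindex) (auto simp: inj_on_def)
  qed (use assms in \<open>auto intro!: finprod_closed\<close>)
  finally show ?thesis by simp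
qed

lemma path_range_append:
  assumes "path_range E y = fst z"
  shows "path_range E (fst y, snd y @ snd z) = path_range E z"
  using assms by (auto simp: path_range_def pre_digraph.awalk_verts_conv)

lemma path_range_Nil: "path_range E (v, []) = v"
  by (simp add: path_range_def pre_digraph.awalk_verts.simps)

lemma (in wf_digraph) paths_range_in_verts: "x \<in> paths G \<Longrightarrow> path_range G x \<in> verts G"
  by (auto simp: paths_def path_range_def)

lemma (in wf_digraph) paths_fst_in_verts: "x \<in> paths G \<Longrightarrow> fst x \<in> verts G"
  by (auto simp: paths_def)

lemma (in wf_digraph) paths_Nil: "(v, []) \<in> paths G \<longleftrightarrow> v \<in> verts G"
  by (auto simp: paths_def awalk_Nil_iff)

lemma (in wf_digraph) paths_append:
  assumes "y \<in> paths G" "z \<in> paths G" "path_range G y = fst z"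
  shows "(fst y, snd y @ snd z) \<in> paths G"
proof -
  obtain v where v: "awalk (fst y) (snd y) v" using assms(1) by (auto simp: paths_def)
  then have "v = path_range G y" by (auto simp: path_range_def)
  with v assms(2,3) show ?thesis by (auto simp: paths_def intro: awalk_appendI)
qed

lemma finite_path_factorizations [simp]: "finite (path_factorizations E x)"
proof (rule finite_subset)
  let ?f = "\<lambda>n. let y = (fst x, take n (snd x)) in (y, (path_range E y, drop n (snd x)))"
  show "path_factorizations E x \<subseteq> ?f ` {..length (snd x)}"
  proof
    fix w assume w: "w \<in> path_factorizations E x"
    obtain u p v q where yz: "w = ((u, p), (v, q))" by (metis surj_pair)
    have "w = ?f (length p)" "length p \<le> length (snd x)"
      using w by (auto simp: yz path_factorizations_def)
    then show "w \<in> ?f ` {..length (snd x)}" by auto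
  qed
qed simp

locale path_algebra_over = K?: field K + E?: fin_digraph E
  for K :: "('k, 'x) ring_scheme" (structure) and E :: "('v, 'e) pre_digraph" (structure)
begin

abbreviation "A \<equiv> path_algebra K E"

lemma carrier_A:
  "f \<in> carrier A \<longleftrightarrow> (\<forall>x. f x \<in> carrier K) \<and> (\<forall>x. x \<notin> paths E \<longrightarrow> f x = \<zero>\<^bsub>K\<^esub>) \<and>
     finite {x. f x \<noteq> \<zero>\<^bsub>K\<^esub>}"
  by (simp add: path_algebra_def)

lemma coeff_closed: "f \<in> carrier A \<Longrightarrow> f x \<in> carrier K"
  unfolding carrier_A by blast

lemma mult_A: "(f \<otimes>\<^bsub>A\<^esub> g) x = (\<Oplus>\<^bsub>K\<^esub>yz\<in>path_factorizations E x. f (fst yz) \<otimes>\<^bsub>K\<^esub> g (snd yz))"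
  and one_A: "\<one>\<^bsub>A\<^esub> x = (if fst x \<in> verts E \<and> snd x = [] then \<one>\<^bsub>K\<^esub> else \<zero>\<^bsub>K\<^esub>)"
  and add_A: "(f \<oplus>\<^bsub>A\<^esub> g) x = f x \<oplus>\<^bsub>K\<^esub> g x"
  and zero_A: "\<zero>\<^bsub>A\<^esub> x = \<zero>\<^bsub>K\<^esub>"
  and smult_A: "(c \<odot>\<^bsub>A\<^esub> f) x = c \<otimes>\<^bsub>K\<^esub> f x"
  by (simp_all add: path_algebra_def)

lemma one_closed_A: "\<one>\<^bsub>A\<^esub> \<in> carrier A"
proof -
  have "{x. \<one>\<^bsub>A\<^esub> x \<noteq> \<zero>\<^bsub>K\<^esub>} \<subseteq> (\<lambda>v. (v, [])) ` verts E"
    by (auto simp: one_A split: if_splits)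
  then have "finite {x. \<one>\<^bsub>A\<^esub> x \<noteq> \<zero>\<^bsub>K\<^esub>}" by (rule finite_subset) simp
  then show ?thesis by (auto simp: carrier_A one_A paths_Nil)
qed

lemma mult_closed_A:
  assumes f: "f \<in> carrier A" and g: "g \<in> carrier A"
  shows "f \<otimes>\<^bsub>A\<^esub> g \<in> carrier A"
proof -
  let ?S = "\<lambda>f. {x. f x \<noteq> \<zero>\<^bsub>K\<^esub>}"
  have "?S (f \<otimes>\<^bsub>A\<^esub> g) \<subseteq> (\<lambda>(y, z). (fst y, snd y @ snd z)) ` (?S f \<times> ?S g)"
  proof
    fix x assume x: "x \<in> ?S (f \<otimes>\<^bsub>A\<^esub> g)"
    have "\<exists>yz\<in>path_factorizations E x. f (fst yz) \<otimes>\<^bsub>K\<^esub> g (snd yz) \<noteq> \<zero>\<^bsub>K\<^esub>"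
    proof (rule ccontr)
      assume "\<not> ?thesis"
      then have "(f \<otimes>\<^bsub>A\<^esub> g) x = \<zero>\<^bsub>K\<^esub>" unfolding mult_A by (intro K.add.finprod_one_eqI) auto
      with x show False by simp
    qed
    then obtain w where w: "w \<in> path_factorizations E x"
      and nz: "f (fst w) \<otimes>\<^bsub>K\<^esub> g (snd w) \<noteq> \<zero>\<^bsub>K\<^esub>" by blast
    have "f (fst w) \<noteq> \<zero>\<^bsub>K\<^esub>" using nz coeff_closed[OF g] by (metis K.l_null)
    moreover have "g (snd w) \<noteq> \<zero>\<^bsub>K\<^esub>" using nz coeff_closed[OF f] by (metis K.r_null)
    ultimately have "w \<in> ?S f \<times> ?S g" by (cases w) simp
    moreover have "x = (\<lambda>(y, z). (fst y, snd y @ snd z)) w"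
      using w by (cases w) (simp add: path_factorizations_def)
    ultimately show "x \<in> (\<lambda>(y, z). (fst y, snd y @ snd z)) ` (?S f \<times> ?S g)"
      by (rule rev_image_eqI)
  qed
  moreover have "finite (?S f \<times> ?S g)"
    using f g unfolding carrier_A by (intro finite_cartesian_product) blast+
  ultimately have fin: "finite (?S (f \<otimes>\<^bsub>A\<^esub> g))" by (rule finite_subset[OF _ finite_imageI])
  have "(f \<otimes>\<^bsub>A\<^esub> g) x = \<zero>\<^bsub>K\<^esub>" if "x \<notin> paths E" for x
  proof -
    have "path_factorizations E x = {}" using that paths_append by (fastforce simp: path_factorizations_def)
    then show ?thesis by (simp add: mult_A)
  qed
  moreover have "(f \<otimes>\<^bsub>A\<^esub> g) x \<in> carrier K" for x
    unfolding mult_A by (intro K.finsum_closed) (auto simp: coeff_closed[OF f] coeff_closed[OF g])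
  ultimately show ?thesis using fin unfolding carrier_A by blast
qed

lemma l_one_A:
  assumes f: "f \<in> carrier A" shows "\<one>\<^bsub>A\<^esub> \<otimes>\<^bsub>A\<^esub> f = f"
proof
  fix x
  show "(\<one>\<^bsub>A\<^esub> \<otimes>\<^bsub>A\<^esub> f) x = f x"
  proof (cases "x \<in> paths E")
    case True
    let ?w = "((fst x, []), x)"
    have w: "?w \<in> path_factorizations E x"
      using True by (simp add: path_factorizations_def paths_Nil paths_fst_in_verts path_range_Nil)
    have z: "\<one>\<^bsub>A\<^esub> (fst yz) \<otimes>\<^bsub>K\<^esub> f (snd yz) = \<zero>\<^bsub>K\<^esub>"
      if "yz \<in> path_factorizations E x - {?w}" for yz
    proof -
      have "snd (fst yz) \<noteq> []"
        using that by (cases yz) (auto simp: path_factorizations_def path_range_Nil)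
      then show ?thesis by (simp add: one_A coeff_closed[OF f])
    qed
    have "(\<one>\<^bsub>A\<^esub> \<otimes>\<^bsub>A\<^esub> f) x = (\<Oplus>\<^bsub>K\<^esub>yz\<in>{?w}. \<one>\<^bsub>A\<^esub> (fst yz) \<otimes>\<^bsub>K\<^esub> f (snd yz))"
      unfolding mult_A using w z
      by (intro K.add.finprod_mono_neutral_cong_right) (auto simp: coeff_closed[OF f] coeff_closed[OF one_closed_A])
    also have "\<dots> = f x" using True by (simp add: one_A coeff_closed[OF f] paths_fst_in_verts)
    finally show ?thesis .
  next
    case False
    then show ?thesis using f mult_closed_A[OF one_closed_A f] unfolding carrier_A by metis
  qed
qed

lemma r_one_A:
  assumes f: "f \<in> carrier A" shows "f \<otimes>\<^bsub>A\<^esub> \<one>\<^bsub>A\<^esub> = f"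
proof
  fix x
  show "(f \<otimes>\<^bsub>A\<^esub> \<one>\<^bsub>A\<^esub>) x = f x"
  proof (cases "x \<in> paths E")
    case True
    let ?w = "(x, (path_range E x, []))"
    have w: "?w \<in> path_factorizations E x"
      using True by (simp add: path_factorizations_def paths_Nil paths_range_in_verts)
    have z: "f (fst yz) \<otimes>\<^bsub>K\<^esub> \<one>\<^bsub>A\<^esub> (snd yz) = \<zero>\<^bsub>K\<^esub>"
      if "yz \<in> path_factorizations E x - {?w}" for yz
    proof -
      have "snd (snd yz) \<noteq> []"
        using that by (cases yz) (auto simp: path_factorizations_def)
      then show ?thesis by (simp add: one_A coeff_closed[OF f])
    qed
    have "(f \<otimes>\<^bsub>A\<^esub> \<one>\<^bsub>A\<^esub>) x = (\<Oplus>\<^bsub>K\<^esub>yz\<in>{?w}. f (fst yz) \<otimes>\<^bsub>K\<^esub> \<one>\<^bsub>A\<^esub> (snd yz))"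
      unfolding mult_A using w z
      by (intro K.add.finprod_mono_neutral_cong_right) (auto simp: coeff_closed[OF f] coeff_closed[OF one_closed_A])
    also have "\<dots> = f x" using True by (simp add: one_A coeff_closed[OF f] paths_range_in_verts)
    finally show ?thesis .
  next
    case False
    then show ?thesis using f mult_closed_A[OF f one_closed_A] unfolding carrier_A by metis
  qed
qed

lemma m_assoc_A:
  assumes f: "f \<in> carrier A" and g: "g \<in> carrier A" and h: "h \<in> carrier A"
  shows "f \<otimes>\<^bsub>A\<^esub> g \<otimes>\<^bsub>A\<^esub> h = f \<otimes>\<^bsub>A\<^esub> (g \<otimes>\<^bsub>A\<^esub> h)"
proof
  fix x
  note [simp] = coeff_closed[OF f] coeff_closed[OF g] coeff_closed[OF h]
  let ?P = "path_factorizations E"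
  let ?S = "SIGMA yz:?P x. ?P (fst yz)" and ?T = "SIGMA yz:?P x. ?P (snd yz)"
  let ?s = "\<lambda>w. f (fst (snd w)) \<otimes>\<^bsub>K\<^esub> g (snd (snd w)) \<otimes>\<^bsub>K\<^esub> h (snd (fst w))"
  let ?t = "\<lambda>w. f (fst (fst w)) \<otimes>\<^bsub>K\<^esub> (g (fst (snd w)) \<otimes>\<^bsub>K\<^esub> h (snd (snd w)))"
  let ?\<phi> = "\<lambda>((y, z), (a, b)). ((a, (fst b, snd b @ snd z)), (b, z))"
  have "(f \<otimes>\<^bsub>A\<^esub> g \<otimes>\<^bsub>A\<^esub> h) x =
      (\<Oplus>\<^bsub>K\<^esub>yz\<in>?P x. \<Oplus>\<^bsub>K\<^esub>ab\<in>?P (fst yz). ?s (yz, ab))"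
    unfolding mult_A by (intro K.add.finprod_cong') (auto simp: K.finsum_ldistr intro!: K.finsum_closed)
  also have "\<dots> = finsum K ?s ?S"
    by (intro K.add.finprod_Sigma) auto
  also have "\<dots> = finsum K (\<lambda>w. ?t (?\<phi> w)) ?S"
    by (intro K.add.finprod_cong') (auto simp: K.m_assoc)
  also have "\<dots> = finsum K ?t (?\<phi> ` ?S)"
  proof (rule K.add.finprod_reindex[symmetric])
    show "?t \<in> ?\<phi> ` ?S \<rightarrow> carrier K" by auto
    show "inj_on ?\<phi> ?S" by (auto simp: inj_on_def path_factorizations_def)
  qed
  also have "?\<phi> ` ?S = ?T"
  proof
    show "?\<phi> ` ?S \<subseteq> ?T"
      by (auto simp: path_factorizations_def) (metis fst_conv snd_conv paths_append path_range_append)+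
    show "?T \<subseteq> ?\<phi> ` ?S"
    proof
      fix w assume w: "w \<in> ?T"
      obtain a c b z where weq: "w = ((a, c), (b, z))" by (metis surj_pair)
      have abz: "a \<in> paths E" "b \<in> paths E" "z \<in> paths E" "path_range E a = fst b"
          "path_range E b = fst z" "c = (fst b, snd b @ snd z)" "x = (fst a, snd a @ snd c)"
        using w by (auto simp: weq path_factorizations_def)
      let ?y = "(fst a, snd a @ snd b)"
      have "((?y, z), (a, b)) \<in> ?S"
        using abz paths_append[of a b] path_range_append[of E a b]
        by (simp add: path_factorizations_def)
      moreover have "w = ?\<phi> ((?y, z), (a, b))" using abz weq by simp
      ultimately show "w \<in> ?\<phi> ` ?S" by (rule rev_image_eqI)
    qed
  qed
  also have "finsum K ?t ?T = (\<Oplus>\<^bsub>K\<^esub>yz\<in>?P x. \<Oplus>\<^bsub>K\<^esub>ab\<in>?P (snd yz). ?t (yz, ab))"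
    by (intro K.add.finprod_Sigma[symmetric]) auto
  also have "\<dots> = (f \<otimes>\<^bsub>A\<^esub> (g \<otimes>\<^bsub>A\<^esub> h)) x"
    unfolding mult_A by (intro K.add.finprod_cong') (auto simp: K.finsum_rdistr intro!: K.finsum_closed)
  finally show "(f \<otimes>\<^bsub>A\<^esub> g \<otimes>\<^bsub>A\<^esub> h) x = (f \<otimes>\<^bsub>A\<^esub> (g \<otimes>\<^bsub>A\<^esub> h)) x" .
qed

lemma vectorspace_A: "vectorspace K A"
proof -
  have F: "left_module K (finsupp_lmod K (paths E))"
    by (rule left_module_finsupp) (rule K.ring_axioms)
  interpret F: left_module K "finsupp_lmod K (paths E)" by (fact F)
  have eq: "carrier A = carrier (finsupp_lmod K (paths E))" "zero A = zero (finsupp_lmod K (paths E))"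
    "add A = add (finsupp_lmod K (paths E))" "smult A = smult (finsupp_lmod K (paths E))"
    by (auto simp: path_algebra_def finsupp_lmod_def)
  have "abelian_group A"
    by (rule abelian_groupI) (auto simp: eq F.M.a_ac intro: F.M.l_neg F.M.a_inv_closed)
  then have "module K A"
    by (intro moduleI K.is_cring)
       (auto simp: eq F.smult_l_distr F.smult_r_distr F.smult_assoc1)
  then show ?thesis by (simp add: vectorspace_def K.field_axioms)
qed

lemma ring_A: "ring A"
proof -
  interpret V: vectorspace K A by (rule vectorspace_A)
  show ?thesis
  proof (rule ringI)
    show "abelian_group A" by (rule V.abelian_group_axioms)
    show "monoid A"
      by (rule monoidI) (auto simp: mult_closed_A one_closed_A l_one_A r_one_A m_assoc_A)
    fix f g h assume f: "f \<in> carrier A" and g: "g \<in> carrier A" and h: "h \<in> carrier A"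
    note [simp] = coeff_closed[OF f] coeff_closed[OF g] coeff_closed[OF h]
    show "(f \<oplus>\<^bsub>A\<^esub> g) \<otimes>\<^bsub>A\<^esub> h = f \<otimes>\<^bsub>A\<^esub> h \<oplus>\<^bsub>A\<^esub> g \<otimes>\<^bsub>A\<^esub> h"
    proof
      fix x show "((f \<oplus>\<^bsub>A\<^esub> g) \<otimes>\<^bsub>A\<^esub> h) x = (f \<otimes>\<^bsub>A\<^esub> h \<oplus>\<^bsub>A\<^esub> g \<otimes>\<^bsub>A\<^esub> h) x"
        by (simp add: mult_A add_A K.l_distr K.finsum_addf)
    qed
    show "h \<otimes>\<^bsub>A\<^esub> (f \<oplus>\<^bsub>A\<^esub> g) = h \<otimes>\<^bsub>A\<^esub> f \<oplus>\<^bsub>A\<^esub> h \<otimes>\<^bsub>A\<^esub> g"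
    proof
      fix x show "(h \<otimes>\<^bsub>A\<^esub> (f \<oplus>\<^bsub>A\<^esub> g)) x = (h \<otimes>\<^bsub>A\<^esub> f \<oplus>\<^bsub>A\<^esub> h \<otimes>\<^bsub>A\<^esub> g) x"
        by (simp add: mult_A add_A K.r_distr K.finsum_addf)
    qed
  qed
qed

lemma smult_mult_A:
  assumes "c \<in> carrier K" "f \<in> carrier A" "g \<in> carrier A"
  shows "(c \<odot>\<^bsub>A\<^esub> f) \<otimes>\<^bsub>A\<^esub> g = c \<odot>\<^bsub>A\<^esub> (f \<otimes>\<^bsub>A\<^esub> g)"
    and "f \<otimes>\<^bsub>A\<^esub> (c \<odot>\<^bsub>A\<^esub> g) = c \<odot>\<^bsub>A\<^esub> (f \<otimes>\<^bsub>A\<^esub> g)"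
proof -
  note [simp] = coeff_closed[OF assms(2)] coeff_closed[OF assms(3)] assms(1)
  show "(c \<odot>\<^bsub>A\<^esub> f) \<otimes>\<^bsub>A\<^esub> g = c \<odot>\<^bsub>A\<^esub> (f \<otimes>\<^bsub>A\<^esub> g)"
    by (auto simp: fun_eq_iff mult_A smult_A K.m_assoc K.finsum_rdistr)
  have "f y \<otimes>\<^bsub>K\<^esub> (c \<otimes>\<^bsub>K\<^esub> g z) = c \<otimes>\<^bsub>K\<^esub> (f y \<otimes>\<^bsub>K\<^esub> g z)" for y z
    by (simp add: K.m_lcomm)
  then show "f \<otimes>\<^bsub>A\<^esub> (c \<odot>\<^bsub>A\<^esub> g) = c \<odot>\<^bsub>A\<^esub> (f \<otimes>\<^bsub>A\<^esub> g)"
    by (auto simp: fun_eq_iff mult_A smult_A K.finsum_rdistr)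
qed

lemma vectorspace_restrict_scalars:
  assumes "left_module A M"
  shows "vectorspace K (restrict_scalars A M)"
proof -
  interpret M: left_module A M by fact
  interpret V: vectorspace K A by (rule vectorspace_A)
  let ?M = "restrict_scalars A M"
  have c1: "c \<odot>\<^bsub>A\<^esub> \<one>\<^bsub>A\<^esub> \<in> carrier A" if "c \<in> carrier K" for c
    using that one_closed_A by simp
  have cd: "(c \<otimes>\<^bsub>K\<^esub> d) \<odot>\<^bsub>A\<^esub> \<one>\<^bsub>A\<^esub> = (c \<odot>\<^bsub>A\<^esub> \<one>\<^bsub>A\<^esub>) \<otimes>\<^bsub>A\<^esub> (d \<odot>\<^bsub>A\<^esub> \<one>\<^bsub>A\<^esub>)"
    if "c \<in> carrier K" "d \<in> carrier K" for c d
    using that c1 one_closed_A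
    by (simp add: smult_mult_A(1) l_one_A V.smult_assoc1)
  have ag: "abelian_group ?M"
    by (rule abelian_groupI)
       (auto simp: restrict_scalars_def M.a_ac intro: M.M.l_neg M.M.a_inv_closed)
  have "module K ?M"
    by (rule moduleI[OF K.is_cring ag])
       (auto simp: restrict_scalars_def c1 cd V.smult_l_distr one_closed_A
          M.smult_l_distr M.smult_r_distr M.smult_assoc1)
  then show ?thesis by (simp add: vectorspace_def K.field_axioms)
qed

end

end

(*
Write L = V / N with V free on B and N finitely generated.  The elements x b, for x a path and b in B,
form a K-basis of V, which is a forest: the descendants of x b are the y x b.  Fix a well-order of
this basis that is compatible with prepending paths.  The leading monomials of elements of N are
closed under descendants, and because N is finitely generated they are the descendants of finitely
many nodes T (a one-sided Groebner basis of N: the products y g_t have pairwise distinct leading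
monomials y t).  Let W0 be the set of nodes without any descendant that is a leading monomial of N.
The span of W0 meets N in zero, and it is the direct sum of the modules A w, w minimal in W0, each a
left ideal A p of A for a trivial path p; hence its image Q in L is projective.  Every remaining node
is either a leading monomial of N, and so reducible modulo N, or an ancestor of an element of T, and
there are only finitely many of those.
*)

theory Submission
  imports Defs
begin

section \<open>Modules over noncommutative rings\<close>

text \<open>The path algebra need not be Noetherian (one vertex with two loops gives a free
  algebra), so no chain condition makes T finite. The absence of cancellation does: distinct minimal
  nodes have no common descendant, so a combination of products y g_t always leads with a descendant
  of some t that occurs in it. The generators of N involve only finitely many g_t, and therefore
  every leading monomial of N descends from one of those t. A path y need not compose with t. Then y
  t vanishes while y may act nontrivially on lower terms of g_t, and control of the leading term is
  lost. Each g_t is therefore multiplied by the trivial path at the source of t, which keeps the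
  leading term and removes every term that starts at another vertex. Ancestors correspond to
  suffixes of a single path; they are linearly ordered and finite in number. The first fact
  separates the trees below minimal nodes, the second bounds the codimension. Since B may be
  infinite, there may be infinitely many nodes of one length, so termination of the division rests
  on a well-order and not on counting.\<close>

context left_module
begin

lemma smult_minus_one: "x \<in> carrier M \<Longrightarrow> (\<ominus>\<^bsub>R\<^esub> \<one>\<^bsub>R\<^esub>) \<odot>\<^bsub>M\<^esub> x = \<ominus>\<^bsub>M\<^esub> x"
proof -
  assume x: "x \<in> carrier M"
  have "(\<ominus>\<^bsub>R\<^esub> \<one>\<^bsub>R\<^esub>) \<odot>\<^bsub>M\<^esub> x \<oplus>\<^bsub>M\<^esub> x = (\<ominus>\<^bsub>R\<^esub> \<one>\<^bsub>R\<^esub> \<oplus>\<^bsub>R\<^esub> \<one>\<^bsub>R\<^esub>) \<odot>\<^bsub>M\<^esub> x"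
    using x by (simp add: smult_l_distr)
  also have "\<dots> = \<zero>\<^bsub>M\<^esub>" using x by (simp add: R.l_neg smult_l_null)
  finally show ?thesis using x by (simp add: M.minus_equality)
qed

text \<open>Negatives come from the scalar -1, so closure under zero, sums and scalars is
  enough.\<close>

lemma lmod_submoduleI:
  assumes "H \<subseteq> carrier M" "\<zero>\<^bsub>M\<^esub> \<in> H"
    and "\<And>x y. \<lbrakk>x \<in> H; y \<in> H\<rbrakk> \<Longrightarrow> x \<oplus>\<^bsub>M\<^esub> y \<in> H"
    and sm: "\<And>a x. \<lbrakk>a \<in> carrier R; x \<in> H\<rbrakk> \<Longrightarrow> a \<odot>\<^bsub>M\<^esub> x \<in> H"
  shows "Module.submodule H R M"
proof -
  have "\<ominus>\<^bsub>M\<^esub> x \<in> H" if "x \<in> H" for x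
  proof -
    have "\<ominus>\<^bsub>M\<^esub> x = (\<ominus>\<^bsub>R\<^esub> \<one>\<^bsub>R\<^esub>) \<odot>\<^bsub>M\<^esub> x"
      by (rule smult_minus_one[symmetric]) (use that assms(1) in auto)
    then show ?thesis using sm[OF _ that] by simp
  qed
  then show ?thesis
    using assms
    by (intro Module.submodule.intro subgroup.intro Module.submodule_axioms.intro)
       (auto simp: a_inv_def)
qed

lemma lmod_submoduleD:
  assumes "Module.submodule H R M"
  shows "H \<subseteq> carrier M" "\<zero>\<^bsub>M\<^esub> \<in> H"
    and "\<And>x y. \<lbrakk>x \<in> H; y \<in> H\<rbrakk> \<Longrightarrow> x \<oplus>\<^bsub>M\<^esub> y \<in> H"
    and "\<And>a x. \<lbrakk>a \<in> carrier R; x \<in> H\<rbrakk> \<Longrightarrow> a \<odot>\<^bsub>M\<^esub> x \<in> H"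
proof -
  interpret H: Module.submodule H R M by fact
  show "H \<subseteq> carrier M" "\<zero>\<^bsub>M\<^esub> \<in> H"
    using H.subset H.one_closed by simp_all
  show "\<And>x y. \<lbrakk>x \<in> H; y \<in> H\<rbrakk> \<Longrightarrow> x \<oplus>\<^bsub>M\<^esub> y \<in> H" using H.m_closed by simp
  show "\<And>a x. \<lbrakk>a \<in> carrier R; x \<in> H\<rbrakk> \<Longrightarrow> a \<odot>\<^bsub>M\<^esub> x \<in> H" by simp
qed

lemma left_module_submodule:
  assumes "Module.submodule H R M"
  shows "left_module R (M\<lparr>carrier := H\<rparr>)"
proof -
  note H = lmod_submoduleD[OF assms]
  let ?H = "M\<lparr>carrier := H\<rparr>"
  have c: "x \<in> carrier M" if "x \<in> H" for x using H(1) that by auto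
  have "abelian_group ?H"
  proof (rule abelian_groupI)
    fix x assume x: "x \<in> carrier ?H"
    then have "(\<ominus>\<^bsub>R\<^esub> \<one>\<^bsub>R\<^esub>) \<odot>\<^bsub>M\<^esub> x \<in> H" using H(4) by simp
    then show "\<exists>y\<in>carrier ?H. y \<oplus>\<^bsub>?H\<^esub> x = \<zero>\<^bsub>?H\<^esub>"
      using x c by (intro bexI[of _ "(\<ominus>\<^bsub>R\<^esub> \<one>\<^bsub>R\<^esub>) \<odot>\<^bsub>M\<^esub> x"]) (auto simp: smult_minus_one M.l_neg)
  qed (use H c in \<open>auto simp: M.a_ac\<close>)
  then interpret H: abelian_group ?H .
  show ?thesis
    by unfold_locales (use H c in \<open>auto simp: smult_l_distr smult_r_distr smult_assoc1\<close>)
qed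

lemma submodule_finsum:
  assumes "Module.submodule H R M" "finite A" "u \<in> A \<rightarrow> H"
  shows "(\<Oplus>\<^bsub>M\<^esub>v\<in>A. u v) \<in> H"
  using assms(2,3)
proof (induct set: finite)
  case empty
  then show ?case using lmod_submoduleD[OF assms(1)] by simp
next
  case (insert x F)
  then have "u \<in> insert x F \<rightarrow> carrier M" using lmod_submoduleD(1)[OF assms(1)] by blast
  then show ?case using insert lmod_submoduleD(3)[OF assms(1)] by (simp add: Pi_def)
qed

end

lemma submodule_hom_image:
  assumes M: "left_module R M" and N: "left_module R N" and h: "h \<in> module_hom R M N"
    and H: "Module.submodule H R M"
  shows "Module.submodule (h ` H) R N"
proof -
  interpret M: left_module R M by fact
  interpret N: left_module R N by fact
  note HD = M.lmod_submoduleD[OF H]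
  have c: "x \<in> carrier M" if "x \<in> H" for x using HD(1) that by auto
  show ?thesis
  proof (rule N.lmod_submoduleI)
    show "h ` H \<subseteq> carrier N" using module_hom_closed[OF h] c by auto
    show "\<zero>\<^bsub>N\<^esub> \<in> h ` H" using left_module_hom_zero[OF M N h] HD(2) by (metis imageI)
    show "x \<oplus>\<^bsub>N\<^esub> y \<in> h ` H" if "x \<in> h ` H" "y \<in> h ` H" for x y
      using that HD(3) c by (auto simp: module_hom_add[OF h, symmetric])
    show "a \<odot>\<^bsub>N\<^esub> x \<in> h ` H" if "a \<in> carrier R" "x \<in> h ` H" for a x
      using that HD(4) c by (auto simp: module_hom_smult[OF h, symmetric])
  qed
qed

lemma submodule_hom_vimage:
  assumes M: "left_module R M" and N: "left_module R N" and h: "h \<in> module_hom R M N"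
    and H: "Module.submodule H R N"
  shows "Module.submodule {x \<in> carrier M. h x \<in> H} R M"
proof -
  interpret M: left_module R M by fact
  interpret N: left_module R N by fact
  note HD = N.lmod_submoduleD[OF H]
  show ?thesis
    using left_module_hom_zero[OF M N h] HD
    by (intro M.lmod_submoduleI) (auto simp: module_hom_add[OF h] module_hom_smult[OF h])
qed

lemma (in left_module) submodule_carrier: "Module.submodule (carrier M) R M"
  by (rule lmod_submoduleI) auto

lemma (in left_module) submodule_zero: "Module.submodule {\<zero>\<^bsub>M\<^esub>} R M"
  by (rule lmod_submoduleI) (auto simp: smult_r_null)

section \<open>Coefficient functions, quotient maps and linear extensions\<close>

lemma finsupp_lmodD:
  assumes "a \<in> carrier (finsupp_lmod R I)"
  shows "a i \<in> carrier R" "a i \<noteq> \<zero>\<^bsub>R\<^esub> \<Longrightarrow> i \<in> I" "finite {i. a i \<noteq> \<zero>\<^bsub>R\<^esub>}"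
  using assms by (auto simp: finsupp_lmod_def)

lemma (in left_module) quotient_map_hom:
  assumes "Module.submodule Q R M"
  shows "(\<lambda>x. Q +>\<^bsub>M\<^esub> x) \<in> module_hom R M (quotient_lmod M Q)"
    and "(\<lambda>x. Q +>\<^bsub>M\<^esub> x) ` carrier M = carrier (quotient_lmod M Q)"
    and "\<And>x. x \<in> Q \<Longrightarrow> Q +>\<^bsub>M\<^esub> x = \<zero>\<^bsub>quotient_lmod M Q\<^esub>"
proof -
  interpret Q: Module.submodule Q R M by fact
  interpret Q: abelian_subgroup Q M
    using Q.subgroup_axioms M.abelian_group_axioms
    by (intro abelian_subgroupI3) (auto intro: additive_subgroup.intro)
  show car: "(\<lambda>x. Q +>\<^bsub>M\<^esub> x) ` carrier M = carrier (quotient_lmod M Q)"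
    by (auto simp: quotient_lmod_def A_RCOSETS_def')
  have "(Q +>\<^bsub>M\<^esub> x) \<oplus>\<^bsub>quotient_lmod M Q\<^esub> (Q +>\<^bsub>M\<^esub> y) = Q +>\<^bsub>M\<^esub> (x \<oplus>\<^bsub>M\<^esub> y)"
    if "x \<in> carrier M" "y \<in> carrier M" for x y
    using that by (simp add: quotient_lmod_def Q.a_rcos_sum)
  then show "(\<lambda>x. Q +>\<^bsub>M\<^esub> x) \<in> module_hom R M (quotient_lmod M Q)"
    unfolding module_hom_def car[symmetric] by (simp add: quotient_lmod(2)[OF assms])
  show "Q +>\<^bsub>M\<^esub> x = \<zero>\<^bsub>quotient_lmod M Q\<^esub>" if "x \<in> Q" for x
    using that by (simp add: quotient_lmod_def Q.a_rcos_const)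
qed

text \<open>\<open>finsum\<close> refers to the carrier of its record, so the two sums are different
  terms. The inclusion of \<open>H\<close> into \<open>M\<close> is a homomorphism and takes one to
  the other.\<close>

lemma lin_ext_submodule:
  assumes M: "left_module R M" and H: "Module.submodule H R M" and q: "q \<in> I \<rightarrow> H"
    and a: "a \<in> carrier (finsupp_lmod R I)"
  shows "lin_ext R (M\<lparr>carrier := H\<rparr>) q a = lin_ext R M q a"
proof -
  interpret M: left_module R M by fact
  have H': "left_module R (M\<lparr>carrier := H\<rparr>)" by (rule M.left_module_submodule[OF H])
  have id: "(\<lambda>x. x) \<in> module_hom R (M\<lparr>carrier := H\<rparr>) M"
    using M.lmod_submoduleD(1)[OF H] by (auto simp: module_hom_def)
  have "(\<lambda>i. a i \<odot>\<^bsub>M\<^esub> q i) \<in> {i. a i \<noteq> \<zero>\<^bsub>R\<^esub>} \<rightarrow> H"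
    using a q M.lmod_submoduleD(4)[OF H] by (auto simp: finsupp_lmod_def Pi_def)
  then show ?thesis
    unfolding lin_ext_def
    using left_module_hom_finsum[OF H' M id, of "{i. a i \<noteq> \<zero>\<^bsub>R\<^esub>}" "\<lambda>i. a i \<odot>\<^bsub>M\<^esub> q i"] a
    by (simp add: finsupp_lmod_def)
qed

lemma lin_ext_natural:
  assumes M: "left_module R M" and N: "left_module R N" and h: "h \<in> module_hom R M N"
    and q: "q \<in> I \<rightarrow> carrier M" and a: "a \<in> carrier (finsupp_lmod R I)"
    and n: "\<And>i. i \<in> I \<Longrightarrow> n i = h (q i)"
  shows "h (lin_ext R M q a) = lin_ext R N n a"
proof -
  interpret M: left_module R M by fact
  interpret N: left_module R N by fact
  let ?S = "{i. a i \<noteq> \<zero>\<^bsub>R\<^esub>}"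
  have S: "finite ?S" "?S \<subseteq> I" and ac: "\<And>i. a i \<in> carrier R"
    using a by (auto simp: finsupp_lmod_def)
  have "h (lin_ext R M q a) = (\<Oplus>\<^bsub>N\<^esub>i\<in>?S. h (a i \<odot>\<^bsub>M\<^esub> q i))"
    unfolding lin_ext_def using S ac q
    by (intro left_module_hom_finsum[OF M N h]) auto
  also have "\<dots> = (\<Oplus>\<^bsub>N\<^esub>i\<in>?S. a i \<odot>\<^bsub>N\<^esub> n i)"
    using S ac q n module_hom_closed[OF h]
    by (intro N.add.finprod_cong') (auto simp: module_hom_smult[OF h] subset_iff Pi_def)
  finally show ?thesis by (simp add: lin_ext_def)
qed

text \<open>
  Such an \<open>M\<close> is the direct sum of the left ideals \<open>R e\<^sub>i\<close>, each generated by an idempotent.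
\<close>

lemma projective_lmodI:
  fixes R :: "('r, 'x) ring_scheme" and M :: "('r, 'm, 'y) module_scheme"
  assumes M: "left_module R M" and q: "q \<in> I \<rightarrow> carrier M" and e: "e \<in> I \<rightarrow> carrier R"
    and eq: "\<And>i. i \<in> I \<Longrightarrow> e i \<odot>\<^bsub>M\<^esub> q i = q i"
    and surj: "carrier M \<subseteq> lin_ext R M q ` carrier (finsupp_lmod R I)"
    and indep: "\<And>a i. \<lbrakk>a \<in> carrier (finsupp_lmod R I); lin_ext R M q a = \<zero>\<^bsub>M\<^esub>; i \<in> I\<rbrakk>
      \<Longrightarrow> a i \<otimes>\<^bsub>R\<^esub> e i = \<zero>\<^bsub>R\<^esub>"
  shows "projective_lmod R M"
  unfolding projective_lmod_def
proof (intro conjI allI impI M)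
  fix N :: "('r, 'm \<Rightarrow> 'r) module" and N' :: "('r, 'm) module" and g f
  assume "left_module R N \<and> left_module R N' \<and>
      g \<in> module_hom R N N' \<and> g ` carrier N = carrier N' \<and> f \<in> module_hom R M N'"
  then have N: "left_module R N" and N': "left_module R N'" and g: "g \<in> module_hom R N N'"
    and gs: "g ` carrier N = carrier N'" and f: "f \<in> module_hom R M N'" by auto
  interpret M: left_module R M by fact
  interpret N: left_module R N by fact
  interpret N': left_module R N' by fact
  let ?F = "finsupp_lmod R I"
  have F: "left_module R ?F" by (rule left_module_finsupp) (rule M.R.ring_axioms)
  interpret F: left_module R ?F by (rule F)
  have "\<forall>i. \<exists>u. i \<in> I \<longrightarrow> u \<in> carrier N \<and> g u = f (q i)"
  proof
    fix i show "\<exists>u. i \<in> I \<longrightarrow> u \<in> carrier N \<and> g u = f (q i)"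
    proof (cases "i \<in> I")
      case True
      then have "f (q i) \<in> g ` carrier N" using module_hom_closed[OF f] q gs by auto
      then show ?thesis by auto
    qed simp
  qed
  then obtain u where u: "\<And>i. i \<in> I \<Longrightarrow> u i \<in> carrier N" "\<And>i. i \<in> I \<Longrightarrow> g (u i) = f (q i)"
    by metis
  \<comment> \<open>An arbitrary preimage \<open>u i\<close> is corrected by \<open>e i\<close>:
    then \<open>a i\<close> acts on \<open>n i\<close> through the product of \<open>a i\<close> and
    \<open>e i\<close>, the quantity that \<open>indep\<close> controls. The image under
    \<open>g\<close> is still \<open>f (q i)\<close>, because \<open>e i\<close> fixes
    \<open>q i\<close>.\<close>
  define n where "n i = e i \<odot>\<^bsub>N\<^esub> u i" for i
  have nc: "n \<in> I \<rightarrow> carrier N" using e u by (auto simp: n_def Pi_iff)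
  have gn: "g (n i) = f (q i)" if i: "i \<in> I" for i
  proof -
    have "g (n i) = e i \<odot>\<^bsub>N'\<^esub> f (q i)"
      unfolding n_def using e u[OF i] i by (subst module_hom_smult[OF g]) auto
    also have "\<dots> = f (e i \<odot>\<^bsub>M\<^esub> q i)" using e q i by (subst module_hom_smult[OF f]) auto
    finally show ?thesis using eq[OF i] by simp
  qed
  let ?q = "lin_ext R M q" and ?n = "lin_ext R N n"
  note qh = lin_ext_hom[OF M q] and nh = lin_ext_hom[OF N nc]
  have zero: "?n a = \<zero>\<^bsub>N\<^esub>" if a: "a \<in> carrier ?F" and z: "?q a = \<zero>\<^bsub>M\<^esub>" for a
  proof -
    have "a i \<odot>\<^bsub>N\<^esub> n i = \<zero>\<^bsub>N\<^esub>" if "a i \<noteq> \<zero>\<^bsub>R\<^esub>" for i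
    proof -
      have i: "i \<in> I" "a i \<in> carrier R" using a that by (auto simp: finsupp_lmod_def)
      have "a i \<odot>\<^bsub>N\<^esub> n i = (a i \<otimes>\<^bsub>R\<^esub> e i) \<odot>\<^bsub>N\<^esub> u i"
        unfolding n_def using i e u(1)[OF i(1)] by (simp add: N.smult_assoc1 Pi_iff)
      then show ?thesis using indep[OF a z i(1)] u(1)[OF i(1)] by (simp add: N.smult_l_null)
    qed
    then show ?thesis unfolding lin_ext_def by (intro N.add.finprod_one_eqI) auto
  qed
  have uniq: "?n a = ?n b" if a: "a \<in> carrier ?F" and b: "b \<in> carrier ?F" and ab: "?q a = ?q b" for a b
  proof -
    let ?m = "\<ominus>\<^bsub>R\<^esub> \<one>\<^bsub>R\<^esub>"
    have c: "?m \<odot>\<^bsub>?F\<^esub> b \<in> carrier ?F" using b by simp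
    have nb: "?n b \<in> carrier N" "?n a \<in> carrier N" "?q b \<in> carrier M"
      using module_hom_closed[OF nh] module_hom_closed[OF qh] a b by auto
    have "?q (a \<oplus>\<^bsub>?F\<^esub> ?m \<odot>\<^bsub>?F\<^esub> b) = ?q b \<oplus>\<^bsub>M\<^esub> ?m \<odot>\<^bsub>M\<^esub> ?q b"
      using a b c ab by (simp add: module_hom_add[OF qh] module_hom_smult[OF qh])
    then have "?q (a \<oplus>\<^bsub>?F\<^esub> ?m \<odot>\<^bsub>?F\<^esub> b) = \<zero>\<^bsub>M\<^esub>" using nb by (simp add: M.smult_minus_one M.r_neg)
    then have "?n (a \<oplus>\<^bsub>?F\<^esub> ?m \<odot>\<^bsub>?F\<^esub> b) = \<zero>\<^bsub>N\<^esub>" using a c by (intro zero) auto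
    then have "?n a \<oplus>\<^bsub>N\<^esub> \<ominus>\<^bsub>N\<^esub> ?n b = \<zero>\<^bsub>N\<^esub>"
      using a b c nb by (simp add: module_hom_add[OF nh] module_hom_smult[OF nh] N.smult_minus_one)
    then show ?thesis using nb N.minus_equality[of "?n a" "\<ominus>\<^bsub>N\<^esub> ?n b"] by simp
  qed
  \<comment> \<open>\<open>\<rho>\<close> is a mere choice of coefficients and need not be linear.
    By \<open>uniq\<close>, \<open>?n (\<rho> x)\<close> does not depend on the choice, and this
    makes the lift linear.\<close>
  have "\<forall>x. \<exists>a. x \<in> carrier M \<longrightarrow> a \<in> carrier ?F \<and> ?q a = x" using surj by blast
  then obtain \<rho> where \<rho>: "\<And>x. x \<in> carrier M \<Longrightarrow> \<rho> x \<in> carrier ?F" "\<And>x. x \<in> carrier M \<Longrightarrow> ?q (\<rho> x) = x"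
    by metis
  let ?h = "\<lambda>x. ?n (\<rho> x)"
  have "?h \<in> module_hom R M N"
    unfolding module_hom_def
  proof (intro CollectI conjI allI impI)
    show "?h \<in> carrier M \<rightarrow> carrier N" using \<rho>(1) module_hom_closed[OF nh] by auto
    fix x y assume "x \<in> carrier M \<and> y \<in> carrier M"
    then have xy: "x \<in> carrier M" "y \<in> carrier M" by auto
    have "?h (x \<oplus>\<^bsub>M\<^esub> y) = ?n (\<rho> x \<oplus>\<^bsub>?F\<^esub> \<rho> y)"
      using xy \<rho> by (intro uniq) (auto simp: module_hom_add[OF qh])
    then show "?h (x \<oplus>\<^bsub>M\<^esub> y) = ?h x \<oplus>\<^bsub>N\<^esub> ?h y" using xy \<rho>(1) by (simp add: module_hom_add[OF nh])
  next
    fix a x assume "a \<in> carrier R \<and> x \<in> carrier M"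
    then have ax: "a \<in> carrier R" "x \<in> carrier M" by auto
    have "?h (a \<odot>\<^bsub>M\<^esub> x) = ?n (a \<odot>\<^bsub>?F\<^esub> \<rho> x)"
      using ax \<rho> by (intro uniq) (auto simp: module_hom_smult[OF qh])
    then show "?h (a \<odot>\<^bsub>M\<^esub> x) = a \<odot>\<^bsub>N\<^esub> ?h x" using ax \<rho>(1) by (simp add: module_hom_smult[OF nh])
  qed
  moreover have "g (?h x) = f x" if x: "x \<in> carrier M" for x
  proof -
    have "g (?h x) = lin_ext R N' (\<lambda>i. f (q i)) (\<rho> x)"
      by (rule lin_ext_natural[OF N N' g nc \<rho>(1)[OF x]]) (simp add: gn)
    also have "\<dots> = f (?q (\<rho> x))"
      by (rule lin_ext_natural[OF M N' f q \<rho>(1)[OF x], symmetric]) simp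
    finally show ?thesis using \<rho>(2)[OF x] by simp
  qed
  ultimately show "\<exists>h\<in>module_hom R M N. \<forall>x\<in>carrier M. g (h x) = f x"
    by (intro bexI[of _ ?h]) auto
qed

text \<open>Independence and spanning of the basis \<open>B\<close> make \<open>\<iota>\<close> an
  isomorphism from the finitely supported functions onto \<open>F\<close>; \<open>S\<close> consists
  of coordinates of the images in \<open>F\<close> of the finitely many generators of
  \<open>K\<close>. Generation of the kernel is phrased through the submodules that contain
  \<open>S\<close>, the form in which it is later applied to the image of a linear
  extension.\<close>

lemma finitely_related_coordinates:
  fixes L :: "('r, 'm) module"
  assumes "finitely_related TYPE('f) R L"
  obtains B :: "'f set" and \<phi> S where
    "\<phi> \<in> module_hom R (finsupp_lmod R B) L" "\<phi> ` carrier (finsupp_lmod R B) = carrier L"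
    "finite S" "S \<subseteq> {c \<in> carrier (finsupp_lmod R B). \<phi> c = \<zero>\<^bsub>L\<^esub>}"
    "\<And>U. \<lbrakk>Module.submodule U R (finsupp_lmod R B); S \<subseteq> U\<rbrakk> \<Longrightarrow>
      {c \<in> carrier (finsupp_lmod R B). \<phi> c = \<zero>\<^bsub>L\<^esub>} \<subseteq> U"
proof -
  obtain K F :: "('r, 'f) module" and i p where
    ex: "short_exact_lmod R K i F p L" and fr: "free_lmod R F" and fg: "finitely_generated R K"
    using assms unfolding finitely_related_def by blast
  have K: "left_module R K" and F: "left_module R F" and L: "left_module R L"
    and i: "i \<in> module_hom R K F" and p: "p \<in> module_hom R F L"
    and ik: "i ` carrier K = {x \<in> carrier F. p x = \<zero>\<^bsub>L\<^esub>}" and ps: "p ` carrier F = carrier L"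
    using ex unfolding short_exact_lmod_def by auto
  obtain B where B: "B \<subseteq> carrier F" and ind: "lmod_independent R F B" and sp: "lmod_span R F B = carrier F"
    using fr unfolding free_lmod_def by blast
  obtain G where G: "finite G" "G \<subseteq> carrier K" "lmod_span R K G = carrier K"
    using fg unfolding finitely_generated_def by blast
  interpret K: left_module R K by fact
  interpret F: left_module R F by fact
  interpret L: left_module R L by fact
  let ?V = "finsupp_lmod R B"
  have V: "left_module R ?V" by (rule left_module_finsupp) (rule K.R.ring_axioms)
  interpret V: left_module R ?V by (rule V)
  define \<iota> where "\<iota> = lin_ext R F (\<lambda>b. b)"
  have Bp: "(\<lambda>b. b) \<in> B \<rightarrow> carrier F" using B by auto
  have \<iota>: "\<iota> \<in> module_hom R ?V F" unfolding \<iota>_def by (rule lin_ext_hom[OF F Bp])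
  have \<iota>0: "c = \<zero>\<^bsub>?V\<^esub>" if c: "c \<in> carrier ?V" and z: "\<iota> c = \<zero>\<^bsub>F\<^esub>" for c
  proof -
    have "finite {b. c b \<noteq> \<zero>\<^bsub>R\<^esub>}" "{b. c b \<noteq> \<zero>\<^bsub>R\<^esub>} \<subseteq> B" "c \<in> {b. c b \<noteq> \<zero>\<^bsub>R\<^esub>} \<rightarrow> carrier R"
      using c by (auto simp: finsupp_lmod_def)
    then have "\<forall>b\<in>{b. c b \<noteq> \<zero>\<^bsub>R\<^esub>}. c b = \<zero>\<^bsub>R\<^esub>"
      using ind z unfolding lmod_independent_def \<iota>_def lin_ext_def by blast
    then show ?thesis by (auto simp: finsupp_lmod_def)
  qed
  have \<iota>i: "c = d" if c: "c \<in> carrier ?V" and d: "d \<in> carrier ?V" and cd: "\<iota> c = \<iota> d" for c d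
  proof -
    let ?m = "\<ominus>\<^bsub>R\<^esub> \<one>\<^bsub>R\<^esub>"
    have dc: "\<iota> d \<in> carrier F" using module_hom_closed[OF \<iota>] d by auto
    have "\<iota> (c \<oplus>\<^bsub>?V\<^esub> ?m \<odot>\<^bsub>?V\<^esub> d) = \<zero>\<^bsub>F\<^esub>"
      using c d cd dc
      by (simp add: module_hom_add[OF \<iota>] module_hom_smult[OF \<iota>] F.smult_minus_one F.r_neg)
    then have "c \<oplus>\<^bsub>?V\<^esub> \<ominus>\<^bsub>?V\<^esub> d = \<zero>\<^bsub>?V\<^esub>"
      using c d \<iota>0[of "c \<oplus>\<^bsub>?V\<^esub> ?m \<odot>\<^bsub>?V\<^esub> d"] by (simp add: V.smult_minus_one)
    then show ?thesis using c d V.minus_equality[of c "\<ominus>\<^bsub>?V\<^esub> d"] by simp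
  qed
  have \<iota>s: "carrier F \<subseteq> \<iota> ` carrier ?V"
  proof
    fix x assume "x \<in> carrier F"
    then have "x \<in> lmod_span R F B" using sp by simp
    then obtain a A where A: "finite A" "A \<subseteq> B" "a \<in> A \<rightarrow> carrier R"
      and x: "x = (\<Oplus>\<^bsub>F\<^esub>v\<in>A. a v \<odot>\<^bsub>F\<^esub> v)"
      unfolding lmod_span_def by blast
    define c where "c b = (if b \<in> A then a b else \<zero>\<^bsub>R\<^esub>)" for b
    have sub: "{b. c b \<noteq> \<zero>\<^bsub>R\<^esub>} \<subseteq> A" by (auto simp: c_def)
    then have "finite {b. c b \<noteq> \<zero>\<^bsub>R\<^esub>}" using A(1) by (rule finite_subset)
    then have c: "c \<in> carrier ?V" using A by (auto simp: finsupp_lmod_def c_def)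
    have "\<iota> c = (\<Oplus>\<^bsub>F\<^esub>b\<in>A. c b \<odot>\<^bsub>F\<^esub> b)"
      unfolding \<iota>_def by (rule lin_ext_eq[OF F c Bp A(1,2) sub])
    also have "\<dots> = x"
      unfolding x using A B by (intro F.add.finprod_cong') (auto simp: c_def)
    finally show "x \<in> \<iota> ` carrier ?V" using c by blast
  qed
  have "\<exists>c. c \<in> carrier ?V \<and> \<iota> c = i s" if "s \<in> carrier K" for s
  proof -
    have "i s \<in> carrier F" using module_hom_closed[OF i] that by auto
    then have "i s \<in> \<iota> ` carrier ?V" using \<iota>s by (rule rev_subsetD)
    then show ?thesis by auto
  qed
  then obtain \<sigma> where \<sigma>: "\<And>s. s \<in> carrier K \<Longrightarrow> \<sigma> s \<in> carrier ?V" "\<And>s. s \<in> carrier K \<Longrightarrow> \<iota> (\<sigma> s) = i s"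
    by metis
  define \<phi> where "\<phi> c = p (\<iota> c)" for c
  have \<iota>c: "\<iota> c \<in> carrier F" if "c \<in> carrier ?V" for c using module_hom_closed[OF \<iota>] that by auto
  have \<phi>: "\<phi> \<in> module_hom R ?V L"
    unfolding module_hom_def \<phi>_def using \<iota>c module_hom_closed[OF p]
    by (auto simp: module_hom_add[OF \<iota>] module_hom_add[OF p] module_hom_smult[OF \<iota>] module_hom_smult[OF p])
  have \<phi>s: "\<phi> ` carrier ?V = carrier L"
  proof
    show "\<phi> ` carrier ?V \<subseteq> carrier L" using module_hom_closed[OF \<phi>] by auto
    show "carrier L \<subseteq> \<phi> ` carrier ?V"
    proof
      fix y assume "y \<in> carrier L"
      then obtain x where x: "x \<in> carrier F" "y = p x" unfolding ps[symmetric] by (elim imageE)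
      from x(1) have "x \<in> \<iota> ` carrier ?V" using \<iota>s by (rule rev_subsetD)
      then show "y \<in> \<phi> ` carrier ?V" using x(2) by (auto simp: \<phi>_def)
    qed
  qed
  have S: "\<sigma> ` G \<subseteq> {c \<in> carrier ?V. \<phi> c = \<zero>\<^bsub>L\<^esub>}"
  proof
    fix c assume "c \<in> \<sigma> ` G"
    then obtain s where s: "s \<in> carrier K" "c = \<sigma> s" using G(2) by auto
    then have "i s \<in> {x \<in> carrier F. p x = \<zero>\<^bsub>L\<^esub>}" unfolding ik[symmetric] by simp
    then show "c \<in> {c \<in> carrier ?V. \<phi> c = \<zero>\<^bsub>L\<^esub>}" using s \<sigma> by (simp add: \<phi>_def)
  qed
  have gen: "{c \<in> carrier ?V. \<phi> c = \<zero>\<^bsub>L\<^esub>} \<subseteq> U"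
    if U: "Module.submodule U R ?V" and SU: "\<sigma> ` G \<subseteq> U" for U
  proof
    fix c assume "c \<in> {c \<in> carrier ?V. \<phi> c = \<zero>\<^bsub>L\<^esub>}"
    then have c: "c \<in> carrier ?V" and "\<iota> c \<in> i ` carrier K" using ik \<iota>c by (auto simp: \<phi>_def)
    from this(2) obtain k where k: "k \<in> carrier K" "\<iota> c = i k" by (elim imageE)
    from k(1) have "k \<in> lmod_span R K G" using G(3) by simp
    then obtain a A where A: "finite A" "A \<subseteq> G" "a \<in> A \<rightarrow> carrier R"
      and ke: "k = (\<Oplus>\<^bsub>K\<^esub>v\<in>A. a v \<odot>\<^bsub>K\<^esub> v)"
      unfolding lmod_span_def by blast
    have AK: "v \<in> carrier K" "a v \<in> carrier R" if "v \<in> A" for v using A G(2) that by auto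
    let ?d = "\<Oplus>\<^bsub>?V\<^esub>v\<in>A. a v \<odot>\<^bsub>?V\<^esub> \<sigma> v"
    have d: "?d \<in> carrier ?V" using AK \<sigma> by (intro V.finsum_closed) auto
    have "\<iota> ?d = (\<Oplus>\<^bsub>F\<^esub>v\<in>A. \<iota> (a v \<odot>\<^bsub>?V\<^esub> \<sigma> v))"
      using AK \<sigma> A(1) by (intro left_module_hom_finsum[OF V F \<iota>]) auto
    also have "\<dots> = (\<Oplus>\<^bsub>F\<^esub>v\<in>A. i (a v \<odot>\<^bsub>K\<^esub> v))"
      using AK \<sigma> module_hom_closed[OF i]
      by (intro F.add.finprod_cong') (auto simp: module_hom_smult[OF i] module_hom_smult[OF \<iota>])
    also have "\<dots> = i k"
      unfolding ke using AK A(1) by (intro left_module_hom_finsum[OF K F i, symmetric]) auto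
    finally have "c = ?d" using \<iota>i[OF c d] k(2) by simp
    also have "?d \<in> U"
    proof (intro V.submodule_finsum[OF U A(1)] Pi_I)
      fix v assume v: "v \<in> A"
      then have "\<sigma> v \<in> U" using A(2) SU by auto
      then show "a v \<odot>\<^bsub>?V\<^esub> \<sigma> v \<in> U" using V.lmod_submoduleD(4)[OF U AK(2)[OF v]] by simp
    qed
    finally show "c \<in> U" .
  qed
  show thesis
  proof (rule that[OF \<phi> \<phi>s _ S])
    show "finite (\<sigma> ` G)" using G(1) by simp
  qed (rule gen)
qed

section \<open>A monomial order on the free module\<close>

lemma (in wf_digraph) paths_append_iff:
  "(u, p @ q) \<in> paths G \<longleftrightarrow> (u, p) \<in> paths G \<and> (path_range G (u, p), q) \<in> paths G"
  by (auto simp: paths_def path_range_def)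

text \<open>The action of the path \<open>y\<close> on the basis element x b, stored as
  \<open>(b, x)\<close>. The source of x is discarded, so the value stands for y x b only when
  \<open>y\<close> ends at that source.\<close>

definition prepend ::
    "'v \<times> 'e list \<Rightarrow> 'f \<times> 'v \<times> 'e list \<Rightarrow> 'f \<times> 'v \<times> 'e list" where
  "prepend y w = (fst w, fst y, snd y @ snd (snd w))"

text \<open>
  Paths are compared by length, then lexicographically from the left, so that prepending is monotone.
  The last letter of the encoding tells apart the trivial paths, and the base points \<open>b\<close>.
\<close>

lemma (in wf_digraph) monomial_order:
  obtains r :: "('f \<times> 'a \<times> 'b list) rel" where
    "wf r" "trans r"
    "\<And>w w'. \<lbrakk>snd w \<in> paths G; snd w' \<in> paths G; w \<noteq> w'\<rbrakk> \<Longrightarrow> (w, w') \<in> r \<or> (w', w) \<in> r"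
    "\<And>w w' y. \<lbrakk>(w, w') \<in> r; path_range G y = fst (snd w); path_range G y = fst (snd w')\<rbrakk> \<Longrightarrow>
      (prepend y w, prepend y w') \<in> r"
proof -
  obtain s0 :: "('b + 'f \<times> 'a) rel" where s0: "Well_order s0" "Field s0 = UNIV"
    using well_ordering[where 'a = "'b + 'f \<times> 'a"] by auto
  define s where "s = s0 - Id"
  have wf: "wf s" using s0 by (simp add: s_def well_order_on_def)
  have tot: "total s"
    using s0 by (auto simp: s_def well_order_on_def linear_order_on_def total_on_def)
  have tr: "trans s"
    using s0 unfolding s_def well_order_on_def linear_order_on_def partial_order_on_def preorder_on_def
    by (intro trans_diff_Id) auto
  have irr: "irrefl s" by (auto simp: s_def irrefl_def)
  define code :: "'f \<times> 'a \<times> 'b list \<Rightarrow> ('b + 'f \<times> 'a) list" where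
    "code w = map Inl (snd (snd w)) @ [Inr (fst w, path_range G (snd w))]" for w
  define r where "r = inv_image (lenlex s) code"
  have inj: "w = w'" if w: "snd w \<in> paths G" "snd w' \<in> paths G" and c: "code w = code w'" for w w'
  proof -
    obtain b u p where wp: "w = (b, u, p)" by (metis surj_pair)
    obtain b' u' p' where wp': "w' = (b', u', p')" by (metis surj_pair)
    have eq: "p = p'" "b = b'" "path_range G (u, p) = path_range G (u', p')"
      using c by (auto simp: code_def wp wp' inj_map_eq_map)
    \<comment> \<open>A nonempty path has its source fixed by its first arrow; for a trivial path
      the source is the range, which the last letter records.\<close>
    have "u = u'"
    proof (cases p)
      case Nil
      then show ?thesis using eq by (simp add: path_range_Nil)
    next
      case (Cons e q)
      then show ?thesis using w eq(1) by (auto simp: wp wp' paths_def awalk_Cons_iff)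
    qed
    then show ?thesis using eq by (simp add: wp wp')
  qed
  show thesis
  proof (rule that[of r])
    show "wf r" unfolding r_def by (rule wf_inv_image[OF wf_lenlex[OF wf]])
    show "trans r" unfolding r_def by (rule trans_inv_image[OF lenlex_transI[OF tr]])
    show "(w, w') \<in> r \<or> (w', w) \<in> r" if "snd w \<in> paths G" "snd w' \<in> paths G" "w \<noteq> w'" for w w'
      using inj[OF that(1,2)] that(3) total_lenlex[OF tot]
      by (auto simp: r_def total_on_def)
    \<comment> \<open>Prepending adds the same prefix to both codes and leaves the last letter
      alone, since the range of the path does not change. Irreflexivity of \<open>s\<close> lets the
      common prefix be cancelled in \<open>lenlex\<close>.\<close>
    show "(prepend y w, prepend y w') \<in> r"
      if "(w, w') \<in> r" "path_range G y = fst (snd w)" "path_range G y = fst (snd w')" for w w' y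
      using that(1) irr path_range_append[OF that(2)] path_range_append[OF that(3)]
      by (simp add: r_def code_def prepend_def)
  qed
qed

section \<open>Single paths as elements of the path algebra\<close>

context path_algebra_over
begin

definition path_elem :: "'v \<times> 'e list \<Rightarrow> 'v \<times> 'e list \<Rightarrow> 'k" where
  "path_elem y = (\<lambda>x. if x = y then \<one>\<^bsub>K\<^esub> else \<zero>\<^bsub>K\<^esub>)"

lemma path_elem_closed: "y \<in> paths E \<Longrightarrow> path_elem y \<in> carrier A"
proof -
  assume y: "y \<in> paths E"
  have "{x. path_elem y x \<noteq> \<zero>\<^bsub>K\<^esub>} \<subseteq> {y}" by (auto simp: path_elem_def)
  then show ?thesis using y by (auto simp: carrier_A path_elem_def intro: finite_subset)
qed

lemma path_elem_nonzero: "path_elem y x \<noteq> \<zero>\<^bsub>K\<^esub> \<longleftrightarrow> x = y"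
  by (simp add: path_elem_def)

lemma mult_A_nonzero:
  assumes f: "f \<in> carrier A" and g: "g \<in> carrier A" and nz: "(f \<otimes>\<^bsub>A\<^esub> g) x \<noteq> \<zero>\<^bsub>K\<^esub>"
  obtains y z where "(y, z) \<in> path_factorizations E x" "f y \<noteq> \<zero>\<^bsub>K\<^esub>" "g z \<noteq> \<zero>\<^bsub>K\<^esub>"
proof -
  have "\<exists>yz\<in>path_factorizations E x. f (fst yz) \<otimes>\<^bsub>K\<^esub> g (snd yz) \<noteq> \<zero>\<^bsub>K\<^esub>"
  proof (rule ccontr)
    assume "\<not> ?thesis"
    then have "(f \<otimes>\<^bsub>A\<^esub> g) x = \<zero>\<^bsub>K\<^esub>" unfolding mult_A by (intro K.add.finprod_one_eqI) auto
    with nz show False by simp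
  qed
  then obtain w where w: "w \<in> path_factorizations E x"
    and wnz: "f (fst w) \<otimes>\<^bsub>K\<^esub> g (snd w) \<noteq> \<zero>\<^bsub>K\<^esub>" by blast
  show thesis
  proof (rule that)
    show "(fst w, snd w) \<in> path_factorizations E x" using w by simp
    show "f (fst w) \<noteq> \<zero>\<^bsub>K\<^esub>" using wnz coeff_closed[OF g] by (metis K.l_null)
    show "g (snd w) \<noteq> \<zero>\<^bsub>K\<^esub>" using wnz coeff_closed[OF f] by (metis K.r_null)
  qed
qed

text \<open>The device behind the statements that a coefficient does not cancel: only one
  factorization of \<open>x\<close> meets both supports.\<close>

lemma mult_A_single:
  assumes f: "f \<in> carrier A" and g: "g \<in> carrier A" and w: "(y, z) \<in> path_factorizations E x"
    and uniq: "\<And>y' z'. \<lbrakk>(y', z') \<in> path_factorizations E x; f y' \<noteq> \<zero>\<^bsub>K\<^esub>; g z' \<noteq> \<zero>\<^bsub>K\<^esub>\<rbrakk> \<Longrightarrow>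
      y' = y \<and> z' = z"
  shows "(f \<otimes>\<^bsub>A\<^esub> g) x = f y \<otimes>\<^bsub>K\<^esub> g z"
proof -
  note [simp] = coeff_closed[OF f] coeff_closed[OF g]
  have "f (fst yz) \<otimes>\<^bsub>K\<^esub> g (snd yz) = \<zero>\<^bsub>K\<^esub>" if "yz \<in> path_factorizations E x - {(y, z)}" for yz
  proof (cases "f (fst yz) = \<zero>\<^bsub>K\<^esub> \<or> g (snd yz) = \<zero>\<^bsub>K\<^esub>")
    case True
    then show ?thesis by auto
  next
    case False
    then show ?thesis using uniq[of "fst yz" "snd yz"] that by (cases yz) auto
  qed
  then have "(f \<otimes>\<^bsub>A\<^esub> g) x = (\<Oplus>\<^bsub>K\<^esub>yz\<in>{(y, z)}. f (fst yz) \<otimes>\<^bsub>K\<^esub> g (snd yz))"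
    unfolding mult_A using w by (intro K.add.finprod_mono_neutral_cong_right) auto
  then show ?thesis by simp
qed

end

text \<open>The order enters only through these four properties. Totality is restricted to actual
  paths, because the encoding behind the order does not separate triples that share a nonempty list
  of arrows and differ only in the source.\<close>

locale path_free_module = path_algebra_over K E
  for K :: "('k, 'x) ring_scheme" (structure) and E :: "('v, 'e) pre_digraph" (structure) +
  fixes B :: "'f set" and r :: "('f \<times> 'v \<times> 'e list) rel"
  assumes wf_r: "wf r" and trans_r: "trans r"
    and total_r: "\<And>w w'. \<lbrakk>snd w \<in> paths E; snd w' \<in> paths E; w \<noteq> w'\<rbrakk> \<Longrightarrow> (w, w') \<in> r \<or> (w', w) \<in> r"
    and prepend_r: "\<And>w w' y. \<lbrakk>(w, w') \<in> r; path_range E y = fst (snd w);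
        path_range E y = fst (snd w')\<rbrakk> \<Longrightarrow> (prepend y w, prepend y w') \<in> r"
begin

abbreviation "V \<equiv> finsupp_lmod A B"

lemma left_module_V: "left_module A V"
  by (rule left_module_finsupp) (rule ring_A)

sublocale V: left_module A V
  by (rule left_module_V)

text \<open>
  A node \<open>(b, x)\<close> stands for the element \<open>x b\<close> of the free module \<^term>\<open>V\<close> on \<open>B\<close>; the nodes form a
  \<open>K\<close>-basis of \<^term>\<open>V\<close>.
\<close>

definition nodes :: "('f \<times> 'v \<times> 'e list) set" where
  "nodes = B \<times> paths E"

definition descends :: "'f \<times> 'v \<times> 'e list \<Rightarrow> 'f \<times> 'v \<times> 'e list \<Rightarrow> bool" where
  "descends t w \<longleftrightarrow> (\<exists>y\<in>paths E. path_range E y = fst (snd t) \<and> w = prepend y t)"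

text \<open>A relation and not a function, because the zero element has no leading node. Existence
  for the others rests on finite support, uniqueness on the asymmetry of \<open>r\<close>.\<close>

definition lead :: "('f \<Rightarrow> 'v \<times> 'e list \<Rightarrow> 'k) \<Rightarrow> 'f \<times> 'v \<times> 'e list \<Rightarrow> bool" where
  "lead c w \<longleftrightarrow> c (fst w) (snd w) \<noteq> \<zero>\<^bsub>K\<^esub> \<and>
    (\<forall>b x. c b x \<noteq> \<zero>\<^bsub>K\<^esub> \<longrightarrow> (b, x) = w \<or> ((b, x), w) \<in> r)"

lemma lead_nonzero: "lead c w \<Longrightarrow> c (fst w) (snd w) \<noteq> \<zero>\<^bsub>K\<^esub>"
  by (simp add: lead_def)

lemma lead_max: "\<lbrakk>lead c w; c b x \<noteq> \<zero>\<^bsub>K\<^esub>\<rbrakk> \<Longrightarrow> (b, x) = w \<or> ((b, x), w) \<in> r"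
  unfolding lead_def by blast

definition monomial :: "'f \<times> 'v \<times> 'e list \<Rightarrow> 'f \<Rightarrow> 'v \<times> 'e list \<Rightarrow> 'k" where
  "monomial w = (\<lambda>b. if b = fst w then path_elem (snd w) else \<zero>\<^bsub>A\<^esub>)"

lemma carrier_V:
  "c \<in> carrier V \<longleftrightarrow>
    (\<forall>b. c b \<in> carrier A) \<and> (\<forall>b. b \<notin> B \<longrightarrow> c b = \<zero>\<^bsub>A\<^esub>) \<and> finite {b. c b \<noteq> \<zero>\<^bsub>A\<^esub>}"
  by (simp add: finsupp_lmod_def)

lemma V_component: "c \<in> carrier V \<Longrightarrow> c b \<in> carrier A"
  by (simp add: carrier_V)

lemma V_coeff: "c \<in> carrier V \<Longrightarrow> c b x \<in> carrier K"
  by (rule coeff_closed[OF V_component])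

lemma zero_V: "\<zero>\<^bsub>V\<^esub> b x = \<zero>\<^bsub>K\<^esub>"
  and add_V: "(c \<oplus>\<^bsub>V\<^esub> d) b x = c b x \<oplus>\<^bsub>K\<^esub> d b x"
  and smult_V: "(a \<odot>\<^bsub>V\<^esub> c) b = a \<otimes>\<^bsub>A\<^esub> c b"
  by (simp_all add: finsupp_lmod_def zero_A add_A)

lemma scalar_closed: "k \<in> carrier K \<Longrightarrow> k \<odot>\<^bsub>A\<^esub> \<one>\<^bsub>A\<^esub> \<in> carrier A"
proof -
  assume k: "k \<in> carrier K"
  interpret VA: vectorspace K A by (rule vectorspace_A)
  show ?thesis using k one_closed_A by simp
qed

lemma scale_V:
  assumes "k \<in> carrier K" "c \<in> carrier V"
  shows "((k \<odot>\<^bsub>A\<^esub> \<one>\<^bsub>A\<^esub>) \<odot>\<^bsub>V\<^esub> c) b x = k \<otimes>\<^bsub>K\<^esub> c b x"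
  using smult_mult_A(1)[OF assms(1) one_closed_A V_component[OF assms(2), of b]]
  by (simp add: smult_V l_one_A[OF V_component[OF assms(2)]] smult_A)

lemma finsum_V:
  assumes "finite S" "u \<in> S \<rightarrow> carrier V"
  shows "(\<Oplus>\<^bsub>V\<^esub>t\<in>S. u t) b x = (\<Oplus>\<^bsub>K\<^esub>t\<in>S. u t b x)"
  using assms
proof (induct set: finite)
  case empty
  then show ?case by (simp add: zero_V)
next
  case (insert t S)
  then show ?case by (simp add: add_V V_coeff Pi_iff)
qed

section \<open>Finite supports and leading nodes\<close>

lemma V_support:
  assumes c: "c \<in> carrier V" and nz: "c b x \<noteq> \<zero>\<^bsub>K\<^esub>"
  shows "(b, x) \<in> nodes"
proof -
  have "b \<in> B" using c nz by (metis carrier_V zero_A)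
  moreover have "x \<in> paths E" using V_component[OF c] nz by (metis carrier_A)
  ultimately show ?thesis by (simp add: nodes_def)
qed

lemma finite_V_support: "c \<in> carrier V \<Longrightarrow> finite {w. c (fst w) (snd w) \<noteq> \<zero>\<^bsub>K\<^esub>}"
proof -
  assume c: "c \<in> carrier V"
  have "{w. c (fst w) (snd w) \<noteq> \<zero>\<^bsub>K\<^esub>} \<subseteq> (SIGMA b:{b. c b \<noteq> \<zero>\<^bsub>A\<^esub>}. {x. c b x \<noteq> \<zero>\<^bsub>K\<^esub>})"
    by (auto simp: zero_A)
  moreover have "finite \<dots>" using c V_component[OF c] by (intro finite_SigmaI) (auto simp: carrier_V carrier_A)
  ultimately show ?thesis by (rule finite_subset)
qed

lemma finite_has_max:
  assumes "finite X" "X \<noteq> {}" "X \<subseteq> nodes"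
  shows "\<exists>m\<in>X. \<forall>w\<in>X. w = m \<or> (w, m) \<in> r"
  using assms
proof (induct rule: finite_ne_induct)
  case (insert w X)
  then obtain m where m: "m \<in> X" "\<And>v. v \<in> X \<Longrightarrow> v = m \<or> (v, m) \<in> r" by blast
  have p: "snd w \<in> paths E" "snd m \<in> paths E" using insert.prems m(1) by (auto simp: nodes_def)
  show ?case
  proof (cases "(m, w) \<in> r")
    case True
    then have "\<forall>v\<in>insert w X. v = w \<or> (v, w) \<in> r" using m(2) transD[OF trans_r] by blast
    then show ?thesis by blast
  next
    case False
    then have "w = m \<or> (w, m) \<in> r" using total_r[OF p] by blast
    then show ?thesis using m by blast
  qed
qed auto

lemma lead_exists:
  assumes c: "c \<in> carrier V" and nz: "c \<noteq> \<zero>\<^bsub>V\<^esub>"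
  obtains w where "lead c w"
proof -
  let ?X = "{w. c (fst w) (snd w) \<noteq> \<zero>\<^bsub>K\<^esub>}"
  have "\<exists>b x. c b x \<noteq> \<zero>\<^bsub>K\<^esub>"
  proof (rule ccontr)
    assume "\<not> ?thesis"
    then have "c b x = \<zero>\<^bsub>V\<^esub> b x" for b x unfolding zero_V by blast
    then have "c = \<zero>\<^bsub>V\<^esub>" by (intro ext)
    with nz show False by contradiction
  qed
  then have "?X \<noteq> {}" by auto
  moreover have "?X \<subseteq> nodes" using V_support[OF c] by fastforce
  ultimately obtain m where "m \<in> ?X" "\<forall>w\<in>?X. w = m \<or> (w, m) \<in> r"
    using finite_has_max[OF finite_V_support[OF c]] by blast
  then show thesis by (intro that[of m]) (simp add: lead_def)
qed

lemma lead_in_nodes: "\<lbrakk>c \<in> carrier V; lead c w\<rbrakk> \<Longrightarrow> w \<in> nodes"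
  using V_support[of c "fst w" "snd w"] by (simp add: lead_def)

lemma path_elem_smult_nonzero:
  assumes c: "c \<in> carrier V" and y: "y \<in> paths E" and nz: "(path_elem y \<odot>\<^bsub>V\<^esub> c) b x \<noteq> \<zero>\<^bsub>K\<^esub>"
  obtains z where "c b z \<noteq> \<zero>\<^bsub>K\<^esub>" "path_range E y = fst z" "(b, x) = prepend y (b, z)"
proof -
  obtain y' z where yz: "(y', z) \<in> path_factorizations E x" "path_elem y y' \<noteq> \<zero>\<^bsub>K\<^esub>" "c b z \<noteq> \<zero>\<^bsub>K\<^esub>"
    using mult_A_nonzero[OF path_elem_closed[OF y] V_component[OF c] nz[unfolded smult_V]] by blast
  then show thesis using that[of z] by (auto simp: path_elem_nonzero path_factorizations_def prepend_def)
qed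

lemma path_elem_smult:
  assumes c: "c \<in> carrier V" and y: "y \<in> paths E" and w: "snd w \<in> paths E" "path_range E y = fst (snd w)"
  shows "(path_elem y \<odot>\<^bsub>V\<^esub> c) (fst (prepend y w)) (snd (prepend y w)) = c (fst w) (snd w)"
proof -
  have "(path_elem y \<otimes>\<^bsub>A\<^esub> c (fst w)) (snd (prepend y w)) = path_elem y y \<otimes>\<^bsub>K\<^esub> c (fst w) (snd w)"
  proof (rule mult_A_single[OF path_elem_closed[OF y] V_component[OF c]])
    show "(y, snd w) \<in> path_factorizations E (snd (prepend y w))"
      using y w by (simp add: path_factorizations_def prepend_def)
    fix y' z' assume f: "(y', z') \<in> path_factorizations E (snd (prepend y w))" and nz: "path_elem y y' \<noteq> \<zero>\<^bsub>K\<^esub>"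
    have "y' = y" using nz by (simp add: path_elem_nonzero)
    moreover from this have "z' = snd w"
      using f w by (intro prod_eqI) (auto simp: path_factorizations_def prepend_def)
    ultimately show "y' = y \<and> z' = snd w" ..
  qed
  then show ?thesis using V_coeff[OF c] by (simp add: smult_V path_elem_def prepend_def)
qed

text \<open>Multiplication by \<open>y\<close> kills the terms of \<open>c\<close> whose path does
  not start where \<open>y\<close> ends and moves the others by the monotone map
  \<open>prepend y\<close>. The leading term is among the survivors by the hypothesis on
  \<open>y\<close>.\<close>

lemma lead_smult:
  assumes c: "c \<in> carrier V" and l: "lead c w" and y: "y \<in> paths E" "path_range E y = fst (snd w)"
  shows "lead (path_elem y \<odot>\<^bsub>V\<^esub> c) (prepend y w)"
  unfolding lead_def
proof (intro conjI allI impI)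
  have "snd w \<in> paths E" using lead_in_nodes[OF c l] by (auto simp: nodes_def)
  then show "(path_elem y \<odot>\<^bsub>V\<^esub> c) (fst (prepend y w)) (snd (prepend y w)) \<noteq> \<zero>\<^bsub>K\<^esub>"
    using path_elem_smult[OF c y(1) _ y(2)] l by (simp add: lead_def)
  fix b x assume "(path_elem y \<odot>\<^bsub>V\<^esub> c) b x \<noteq> \<zero>\<^bsub>K\<^esub>"
  then obtain z where z: "c b z \<noteq> \<zero>\<^bsub>K\<^esub>" "path_range E y = fst z" "(b, x) = prepend y (b, z)"
    by (rule path_elem_smult_nonzero[OF c y(1)])
  have "(b, z) = w \<or> ((b, z), w) \<in> r" by (rule lead_max[OF l z(1)])
  then show "(b, x) = prepend y w \<or> ((b, x), prepend y w) \<in> r"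
    unfolding z(3) using prepend_r[of "(b, z)" w y] y z(2) by auto
qed

lemma monomial_closed: "w \<in> nodes \<Longrightarrow> monomial w \<in> carrier V"
proof -
  assume w: "w \<in> nodes"
  have "{b. monomial w b \<noteq> \<zero>\<^bsub>A\<^esub>} \<subseteq> {fst w}" by (auto simp: monomial_def)
  then have "finite {b. monomial w b \<noteq> \<zero>\<^bsub>A\<^esub>}" by (rule finite_subset) simp
  then show ?thesis using w by (auto simp: carrier_V monomial_def nodes_def path_elem_closed)
qed

lemma monomial_nonzero: "monomial w b x \<noteq> \<zero>\<^bsub>K\<^esub> \<longleftrightarrow> w = (b, x)"
  by (cases w) (auto simp: monomial_def path_elem_def zero_A)

lemma lead_monomial: "lead (monomial w) w"
  by (cases w) (auto simp: lead_def monomial_nonzero)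

text \<open>Division with remainder, one step for each leading monomial.\<close>

lemma subset_by_lead:
  assumes \<Phi>: "\<Phi> \<subseteq> carrier V" "\<And>f g. \<lbrakk>f \<in> \<Phi>; g \<in> \<Phi>\<rbrakk> \<Longrightarrow> f \<oplus>\<^bsub>V\<^esub> g \<in> \<Phi>"
      "\<And>k f. \<lbrakk>k \<in> carrier K; f \<in> \<Phi>\<rbrakk> \<Longrightarrow> (k \<odot>\<^bsub>A\<^esub> \<one>\<^bsub>A\<^esub>) \<odot>\<^bsub>V\<^esub> f \<in> \<Phi>"
    and U: "\<zero>\<^bsub>V\<^esub> \<in> U" "\<And>f g. \<lbrakk>f \<in> U; g \<in> U\<rbrakk> \<Longrightarrow> f \<oplus>\<^bsub>V\<^esub> g \<in> U"
      "\<And>k f. \<lbrakk>k \<in> carrier K; f \<in> U\<rbrakk> \<Longrightarrow> (k \<odot>\<^bsub>A\<^esub> \<one>\<^bsub>A\<^esub>) \<odot>\<^bsub>V\<^esub> f \<in> U"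
    and step: "\<And>f w. \<lbrakk>f \<in> \<Phi>; lead f w\<rbrakk> \<Longrightarrow> \<exists>u\<in>U \<inter> \<Phi>. lead u w"
  shows "\<Phi> \<subseteq> U"
proof -
  have ind: "\<forall>f\<in>\<Phi>. lead f w \<longrightarrow> f \<in> U" for w
    using wf_r
  proof (induct w rule: wf_induct_rule)
    case (less w)
    show ?case
    proof (intro ballI impI)
      fix f assume f: "f \<in> \<Phi>" and l: "lead f w"
      obtain u where u: "u \<in> U" "u \<in> \<Phi>" "lead u w" using step[OF f l] by blast
      have fV: "f \<in> carrier V" and uV: "u \<in> carrier V" using f u(2) \<Phi>(1) by auto
      note [simp] = V_coeff[OF fV] V_coeff[OF uV]
      let ?\<alpha> = "f (fst w) (snd w)" and ?\<beta> = "u (fst w) (snd w)"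
      have \<beta>: "?\<beta> \<noteq> \<zero>\<^bsub>K\<^esub>" using u(3) by (simp add: lead_def)
      then have inv: "inv\<^bsub>K\<^esub> ?\<beta> \<in> carrier K" "inv\<^bsub>K\<^esub> ?\<beta> \<otimes>\<^bsub>K\<^esub> ?\<beta> = \<one>\<^bsub>K\<^esub>"
        by (simp_all add: field_Units)
      define k where "k = ?\<alpha> \<otimes>\<^bsub>K\<^esub> inv\<^bsub>K\<^esub> ?\<beta>"
      have k: "k \<in> carrier K" "k \<otimes>\<^bsub>K\<^esub> ?\<beta> = ?\<alpha>" using inv by (simp_all add: k_def K.m_assoc)
      define f' where "f' = f \<oplus>\<^bsub>V\<^esub> ((\<ominus>\<^bsub>K\<^esub> k) \<odot>\<^bsub>A\<^esub> \<one>\<^bsub>A\<^esub>) \<odot>\<^bsub>V\<^esub> u"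
      have pt: "f' b x = f b x \<oplus>\<^bsub>K\<^esub> (\<ominus>\<^bsub>K\<^esub> k) \<otimes>\<^bsub>K\<^esub> u b x" for b x
        using k uV by (simp add: f'_def add_V scale_V)
      \<comment> \<open>Here it matters that \<open>step\<close> supplies \<open>u\<close> in
        \<open>\<Phi>\<close> as well as in \<open>U\<close>: the remainder stays in
        \<open>\<Phi>\<close>, so the induction hypothesis applies to it.\<close>
      have f'\<Phi>: "f' \<in> \<Phi>" unfolding f'_def using k f u by (intro \<Phi>) auto
      have f'V: "f' \<in> carrier V" using f'\<Phi> \<Phi>(1) by auto
      have feq: "f = f' \<oplus>\<^bsub>V\<^esub> (k \<odot>\<^bsub>A\<^esub> \<one>\<^bsub>A\<^esub>) \<odot>\<^bsub>V\<^esub> u"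
      proof (intro ext)
        fix b x show "f b x = (f' \<oplus>\<^bsub>V\<^esub> (k \<odot>\<^bsub>A\<^esub> \<one>\<^bsub>A\<^esub>) \<odot>\<^bsub>V\<^esub> u) b x"
          using k uV by (simp add: add_V scale_V pt K.l_minus K.a_assoc K.l_neg)
      qed
      have "f' \<in> U"
      proof (cases "f' = \<zero>\<^bsub>V\<^esub>")
        case True
        then show ?thesis using U(1) by simp
      next
        case False
        then obtain v where v: "lead f' v" using lead_exists[OF f'V] by blast
        have w0: "f' (fst w) (snd w) = \<zero>\<^bsub>K\<^esub>" using k by (simp add: pt K.l_minus K.r_neg)
        have nz: "f' (fst v) (snd v) \<noteq> \<zero>\<^bsub>K\<^esub>" using v by (simp add: lead_def)
        then have "f (fst v) (snd v) \<noteq> \<zero>\<^bsub>K\<^esub> \<or> u (fst v) (snd v) \<noteq> \<zero>\<^bsub>K\<^esub>"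
          using k by (auto simp: pt)
        then have "v = w \<or> (v, w) \<in> r"
          using lead_max[OF l, of "fst v" "snd v"] lead_max[OF u(3), of "fst v" "snd v"] by auto
        moreover have "v \<noteq> w" using w0 nz by auto
        ultimately have "(v, w) \<in> r" by simp
        then show ?thesis using less f'\<Phi> v by blast
      qed
      then show "f \<in> U" by (subst feq) (intro U k u)
    qed
  qed
  show ?thesis
  proof
    fix f assume f: "f \<in> \<Phi>"
    show "f \<in> U"
    proof (cases "f = \<zero>\<^bsub>V\<^esub>")
      case False
      then obtain w where "lead f w" using lead_exists f \<Phi>(1) by blast
      then show ?thesis using ind f by blast
    qed (simp add: U)
  qed
qed

end

section \<open>Descendants\<close>

context path_free_module
begin

lemma prepend_inj: "prepend y t = prepend y' t \<Longrightarrow> y = y'"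
  by (simp add: prepend_def prod_eq_iff)

lemma prepend_Nil: "prepend (fst (snd w), []) w = w"
  by (simp add: prepend_def)

lemma prepend_in_nodes:
  assumes "t \<in> nodes" "y \<in> paths E" "path_range E y = fst (snd t)"
  shows "prepend y t \<in> nodes"
  using assms paths_append[of y "snd t"] by (auto simp: nodes_def prepend_def)

lemma trivial_path: "t \<in> nodes \<Longrightarrow> (fst (snd t), []) \<in> paths E"
  by (auto simp: nodes_def paths_Nil dest: paths_fst_in_verts)

lemma descends_in_nodes: "\<lbrakk>descends t w; t \<in> nodes\<rbrakk> \<Longrightarrow> w \<in> nodes"
  by (auto simp: descends_def prepend_in_nodes)

lemma descends_refl: "t \<in> nodes \<Longrightarrow> descends t t"
  unfolding descends_def
  by (rule bexI[OF _ trivial_path]) (simp_all add: prepend_Nil path_range_Nil)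

lemma descends_trans:
  assumes "descends s t" "descends t w"
  shows "descends s w"
proof -
  obtain y where y: "y \<in> paths E" "path_range E y = fst (snd s)" "t = prepend y s"
    using assms(1) by (auto simp: descends_def)
  obtain z where z: "z \<in> paths E" "path_range E z = fst (snd t)" "w = prepend z t"
    using assms(2) by (auto simp: descends_def)
  have zy: "path_range E z = fst y" using z(2) by (simp add: y(3) prepend_def)
  show ?thesis
    unfolding descends_def
  proof (intro bexI conjI)
    show "path_range E (fst z, snd z @ snd y) = fst (snd s)" using path_range_append[OF zy] y(2) by simp
    show "w = prepend (fst z, snd z @ snd y) s" by (simp add: z(3) y(3) prepend_def)
    show "(fst z, snd z @ snd y) \<in> paths E" by (rule paths_append[OF z(1) y(1) zy])
  qed
qed

text \<open>Ancestors of \<open>w\<close> keep its base point and carry a suffix of its path; of two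
  suffixes of the same list, the shorter is a suffix of the longer.\<close>

lemma descends_linear:
  assumes "descends s w" "descends t w"
  shows "descends s t \<or> descends t s"
proof -
  have *: "descends t s"
    if y: "y \<in> paths E" "path_range E y = fst (snd s)" "w = prepend y s"
      and z: "z \<in> paths E" "path_range E z = fst (snd t)" "w = prepend z t"
      and le: "length (snd y) \<le> length (snd z)" for s t y z
  proof -
    have eq: "fst s = fst t" "fst y = fst z" "snd y @ snd (snd s) = snd z @ snd (snd t)"
      using y(3) z(3) by (auto simp: prepend_def)
    \<comment> \<open>\<open>y\<close> is a prefix of \<open>z\<close>, and the surplus
      \<open>q\<close> is the path that leads from \<open>t\<close> to its descendant
      \<open>s\<close>.\<close>
    obtain q where q: "snd z = snd y @ q" "snd (snd s) = q @ snd (snd t)"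
      using eq(3) le by (auto simp: append_eq_append_conv_if append_eq_conv_conj) (metis append_take_drop_id)
    let ?q = "(path_range E y, q)"
    have "?q \<in> paths E" using z(1) q(1) eq(2) paths_append_iff[of "fst y" "snd y" q] by (metis prod.collapse)
    moreover have "path_range E ?q = fst (snd t)"
      using path_range_append[of E y ?q] z(2) eq(2) q(1) by (metis fst_conv prod.collapse snd_conv)
    moreover have "s = prepend ?q t"
      using q(2) eq(1) y(2) by (simp add: prepend_def prod_eq_iff)
    ultimately show ?thesis unfolding descends_def by blast
  qed
  obtain y where y: "y \<in> paths E" "path_range E y = fst (snd s)" "w = prepend y s"
    using assms(1) unfolding descends_def by blast
  obtain z where z: "z \<in> paths E" "path_range E z = fst (snd t)" "w = prepend z t"
    using assms(2) unfolding descends_def by blast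
  show ?thesis using *[OF y z] *[OF z y] by linarith
qed

text \<open>An ancestor is determined by the length of the removed prefix, whose range is the source
  of the suffix that remains.\<close>

lemma finite_ancestors: "finite {s. descends s w}"
proof (rule finite_subset)
  let ?f = "\<lambda>n. (fst w, path_range E (fst (snd w), take n (snd (snd w))), drop n (snd (snd w)))"
  show "{s. descends s w} \<subseteq> ?f ` {..length (snd (snd w))}"
  proof
    fix s assume "s \<in> {s. descends s w}"
    then obtain y where y: "path_range E y = fst (snd s)" "w = prepend y s"
      by (auto simp: descends_def)
    have "s = ?f (length (snd y))" using y(1) by (simp add: y(2) prepend_def prod_eq_iff)
    moreover have "length (snd y) \<le> length (snd (snd w))" by (simp add: y(2) prepend_def)
    ultimately show "s \<in> ?f ` {..length (snd (snd w))}" by blast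
  qed
qed simp

definition minimal :: "('f \<times> 'v \<times> 'e list) set \<Rightarrow> ('f \<times> 'v \<times> 'e list) set" where
  "minimal X = {w \<in> X. \<forall>s\<in>X. descends s w \<longrightarrow> s = w}"

text \<open>Passing to a proper ancestor shortens the path, since only a trivial path can be
  prepended without changing the length, and it gives back the same node.\<close>

lemma minimal_exists:
  assumes "X \<subseteq> nodes" "w \<in> X"
  obtains t where "t \<in> minimal X" "descends t w"
proof -
  have "\<exists>t\<in>minimal X. descends t w"
    using assms(2)
  proof (induct "length (snd (snd w))" arbitrary: w rule: less_induct)
    case less
    have w: "w \<in> nodes" using less.prems assms(1) by auto
    show ?case
    proof (cases "w \<in> minimal X")
      case True
      then show ?thesis using descends_refl[OF w] by blast
    next
      case False
      then obtain s where s: "s \<in> X" "descends s w" "s \<noteq> w" using less.prems by (auto simp: minimal_def)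
      then obtain y where y: "path_range E y = fst (snd s)" "w = prepend y s"
        by (auto simp: descends_def)
      have "snd y \<noteq> []"
      proof
        assume "snd y = []"
        then have "y = (fst (snd s), [])" using y(1) path_range_Nil[of E "fst y"] by (cases y) simp
        then show False using y(2) s(3) by (simp add: prepend_Nil)
      qed
      then have "length (snd (snd s)) < length (snd (snd w))" by (simp add: y(2) prepend_def)
      then obtain t where "t \<in> minimal X" "descends t s" using less.hyps s(1) by blast
      then show ?thesis using descends_trans s(2) by blast
    qed
  qed
  then show thesis using that by blast
qed

text \<open>Two ancestors of one node are comparable, and comparable minimal nodes coincide. So the
  trees below the minimal nodes are disjoint, which is the source of every directness claim
  below.\<close>

lemma minimal_antichain:
  assumes "t \<in> minimal X" "t' \<in> minimal X" "descends t w" "descends t' w"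
  shows "t = t'"
  using descends_linear[OF assms(3,4)] assms(1,2) unfolding minimal_def by blast

section \<open>Leading monomials\<close>

lemma r_asym: "(w, w') \<in> r \<Longrightarrow> (w', w) \<notin> r"
  by (rule wf_not_sym[OF wf_r])

lemma lead_unique:
  assumes "lead c w" "lead c w'"
  shows "w = w'"
  using lead_max[OF assms(1) lead_nonzero[OF assms(2)]] lead_max[OF assms(2) lead_nonzero[OF assms(1)]]
    r_asym[of w w'] by auto

lemma path_elem_monomial:
  assumes w: "w \<in> nodes" and y: "y \<in> paths E" "path_range E y = fst (snd w)"
  shows "path_elem y \<odot>\<^bsub>V\<^esub> monomial w = monomial (prepend y w)"
proof (intro ext)
  fix b x
  note mV = monomial_closed[OF w]
  show "(path_elem y \<odot>\<^bsub>V\<^esub> monomial w) b x = monomial (prepend y w) b x"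
  proof (cases "(b, x) = prepend y w")
    case True
    have "snd w \<in> paths E" using w by (auto simp: nodes_def)
    then have "(path_elem y \<odot>\<^bsub>V\<^esub> monomial w) b x = monomial w (fst w) (snd w)"
      using path_elem_smult[OF mV y(1) _ y(2)] True[symmetric] by simp
    also have "\<dots> = monomial (prepend y w) b x"
      unfolding True[symmetric] by (simp add: monomial_def path_elem_def)
    finally show ?thesis .
  next
    case False
    have "monomial (prepend y w) b x = \<zero>\<^bsub>K\<^esub>" using False monomial_nonzero by metis
    moreover have "(path_elem y \<odot>\<^bsub>V\<^esub> monomial w) b x = \<zero>\<^bsub>K\<^esub>"
    proof (rule ccontr)
      assume "(path_elem y \<odot>\<^bsub>V\<^esub> monomial w) b x \<noteq> \<zero>\<^bsub>K\<^esub>"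
      then obtain z where z: "monomial w b z \<noteq> \<zero>\<^bsub>K\<^esub>" "(b, x) = prepend y (b, z)"
        by (rule path_elem_smult_nonzero[OF mV y(1)])
      then show False using False by (simp add: monomial_nonzero)
    qed
    ultimately show ?thesis by simp
  qed
qed

section \<open>Combinations of elements with prescribed leading nodes\<close>

lemma lin_ext_V:
  assumes g: "g \<in> T \<rightarrow> carrier V" and a: "a \<in> carrier (finsupp_lmod A T)"
  shows "lin_ext A V g a b x = (\<Oplus>\<^bsub>K\<^esub>t\<in>{t. a t \<noteq> \<zero>\<^bsub>A\<^esub>}. (a t \<otimes>\<^bsub>A\<^esub> g t b) x)"
proof -
  have fin: "finite {t. a t \<noteq> \<zero>\<^bsub>A\<^esub>}" by (rule finsupp_lmodD(3)[OF a])
  have "(\<lambda>t. a t \<odot>\<^bsub>V\<^esub> g t) \<in> {t. a t \<noteq> \<zero>\<^bsub>A\<^esub>} \<rightarrow> carrier V"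
    using finsupp_lmodD[OF a] g by (auto simp: Pi_iff)
  then show ?thesis unfolding lin_ext_def by (simp add: finsum_V[OF fin] smult_V)
qed

text \<open>Set up for two uses: the reduced generators of a submodule, and the monomials at the
  minimal nodes of \<open>W0\<close>. Under \<open>homogeneous\<close>, a path that does not compose
  with \<open>t\<close> annihilates all of \<open>g t\<close>, not only its leading term.\<close>

context
  fixes T g a
  assumes T: "T \<subseteq> nodes" and g: "g \<in> T \<rightarrow> carrier V" and lead_g: "\<forall>t\<in>T. lead (g t) t"
    and homogeneous: "\<forall>t\<in>T. \<forall>b x. g t b x \<noteq> \<zero>\<^bsub>K\<^esub> \<longrightarrow> fst x = fst (snd t)"
    and a: "a \<in> carrier (finsupp_lmod A T)"
begin

lemma finsupp_coeff: "a t \<in> carrier A" "a t y \<noteq> \<zero>\<^bsub>K\<^esub> \<Longrightarrow> t \<in> T" "a t y \<noteq> \<zero>\<^bsub>K\<^esub> \<Longrightarrow> y \<in> paths E"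
proof -
  show at: "a t \<in> carrier A" by (rule finsupp_lmodD(1)[OF a])
  show "t \<in> T" if "a t y \<noteq> \<zero>\<^bsub>K\<^esub>"
    using that zero_A by (intro finsupp_lmodD(2)[OF a]) metis
  show "y \<in> paths E" if "a t y \<noteq> \<zero>\<^bsub>K\<^esub>" using at that unfolding carrier_A by blast
qed

text \<open>If \<open>y\<close> composes with some term of \<open>g t\<close>, homogeneity makes it
  compose with \<open>t\<close> as well, and monotonicity carries the bound by \<open>t\<close> over
  to a bound by \<open>prepend y t\<close>.\<close>

lemma term_bound:
  assumes at: "a t y \<noteq> \<zero>\<^bsub>K\<^esub>" and fact: "(y, z) \<in> path_factorizations E x" and gz: "g t b z \<noteq> \<zero>\<^bsub>K\<^esub>"
  shows "path_range E y = fst (snd t)" "(b, x) = prepend y t \<or> ((b, x), prepend y t) \<in> r"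
proof -
  have t: "t \<in> T" by (rule finsupp_coeff(2)[OF at])
  have yz: "path_range E y = fst z" "(b, x) = prepend y (b, z)"
    using fact by (auto simp: path_factorizations_def prepend_def)
  then show range: "path_range E y = fst (snd t)" using homogeneous t gz by metis
  have "(b, z) = t \<or> ((b, z), t) \<in> r" by (rule lead_max[OF bspec[OF lead_g t] gz])
  then show "(b, x) = prepend y t \<or> ((b, x), prepend y t) \<in> r"
    unfolding yz(2) using prepend_r[of "(b, z)" t y] yz(1) range by auto
qed

lemma term_nonzero:
  assumes "t \<in> T" "(a t \<otimes>\<^bsub>A\<^esub> g t b) x \<noteq> \<zero>\<^bsub>K\<^esub>"
  obtains y z where "a t y \<noteq> \<zero>\<^bsub>K\<^esub>" "(y, z) \<in> path_factorizations E x" "g t b z \<noteq> \<zero>\<^bsub>K\<^esub>"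
proof -
  have "g t \<in> carrier V" using g assms(1) by auto
  from mult_A_nonzero[OF finsupp_coeff(1) V_component[OF this] assms(2)] show thesis using that by blast
qed

lemma lin_ext_nonzero:
  assumes "lin_ext A V g a b x \<noteq> \<zero>\<^bsub>K\<^esub>"
  obtains t y z where "t \<in> T" "a t y \<noteq> \<zero>\<^bsub>K\<^esub>" "(y, z) \<in> path_factorizations E x" "g t b z \<noteq> \<zero>\<^bsub>K\<^esub>"
proof -
  have "\<exists>t\<in>T. (a t \<otimes>\<^bsub>A\<^esub> g t b) x \<noteq> \<zero>\<^bsub>K\<^esub>"
  proof (rule ccontr)
    assume "\<not> ?thesis"
    then have "lin_ext A V g a b x = \<zero>\<^bsub>K\<^esub>"
      unfolding lin_ext_V[OF g a] using finsupp_lmodD(2)[OF a]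
      by (intro K.add.finprod_one_eqI) blast
    with assms show False by contradiction
  qed
  then show thesis using term_nonzero that by metis
qed

text \<open>
  In an antichain the leading monomials \<open>y t\<close> of the products \<open>y (g t)\<close> are pairwise distinct, so
  the largest of them survives in the sum.
\<close>

lemma lead_lin_ext:
  assumes anti: "\<forall>t\<in>T. \<forall>t'\<in>T. \<forall>w. descends t w \<longrightarrow> descends t' w \<longrightarrow> t = t'"
    and nz: "a t1 y1 \<noteq> \<zero>\<^bsub>K\<^esub>" "path_range E y1 = fst (snd t1)"
  obtains t w where "t \<in> T" "descends t w" "lead (lin_ext A V g a) w"
proof -
  let ?f = "lin_ext A V g a"
  \<comment> \<open>Pairs that do not compose are left out: by homogeneity they contribute nothing
    to the sum.\<close>
  define P where "P = {(t, y). a t y \<noteq> \<zero>\<^bsub>K\<^esub> \<and> path_range E y = fst (snd t)}"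
  define X where "X = (\<lambda>(t, y). prepend y t) ` P"
  have "P \<subseteq> (SIGMA t:{t. a t \<noteq> \<zero>\<^bsub>A\<^esub>}. {y. a t y \<noteq> \<zero>\<^bsub>K\<^esub>})"
    by (auto simp: P_def zero_A)
  moreover have "finite \<dots>"
    using finsupp_lmodD[OF a] by (intro finite_SigmaI) (auto simp: carrier_A)
  ultimately have "finite X" unfolding X_def by (intro finite_imageI) (rule finite_subset)
  moreover have "(t1, y1) \<in> P" using nz by (simp add: P_def)
  then have "X \<noteq> {}" by (auto simp: X_def)
  moreover have "X \<subseteq> nodes"
  proof
    fix w assume "w \<in> X"
    then obtain t y where ty: "a t y \<noteq> \<zero>\<^bsub>K\<^esub>" "path_range E y = fst (snd t)" "w = prepend y t"
      by (auto simp: X_def P_def)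
    have "t \<in> nodes" using T finsupp_coeff(2)[OF ty(1)] by (rule subsetD)
    then show "w \<in> nodes" unfolding ty(3) by (rule prepend_in_nodes[OF _ finsupp_coeff(3)[OF ty(1)] ty(2)])
  qed
  ultimately have "\<exists>m\<in>X. \<forall>w\<in>X. w = m \<or> (w, m) \<in> r" by (rule finite_has_max)
  then obtain m where m: "m \<in> X" "\<And>w. w \<in> X \<Longrightarrow> w = m \<or> (w, m) \<in> r" by blast
  then obtain t0 y0 where ty: "a t0 y0 \<noteq> \<zero>\<^bsub>K\<^esub>" "path_range E y0 = fst (snd t0)" "m = prepend y0 t0"
    by (auto simp: X_def P_def)
  have t0: "t0 \<in> T" and y0: "y0 \<in> paths E" using finsupp_coeff ty(1) by auto
  have desc: "descends t0 m" using ty y0 by (auto simp: descends_def)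
  have gt0: "g t0 \<in> carrier V" using g t0 by auto
  have inX: "prepend y t \<in> X" if "a t y \<noteq> \<zero>\<^bsub>K\<^esub>" "path_range E y = fst (snd t)" for t y
    using that by (force simp: X_def P_def)
  \<comment> \<open>A product that contributes at \<open>m\<close> has its leading node at or above
    \<open>m\<close>, hence equal to \<open>m\<close> by maximality. The antichain then forces
    \<open>t = t0\<close>, and cancelling \<open>t0\<close> on the right forces
    \<open>y = y0\<close>.\<close>
  have only: "t = t0 \<and> y = y0"
    if yz: "a t y \<noteq> \<zero>\<^bsub>K\<^esub>" "(y, z) \<in> path_factorizations E (snd m)" "g t (fst m) z \<noteq> \<zero>\<^bsub>K\<^esub>" for t y z
  proof -
    have range: "path_range E y = fst (snd t)" by (rule term_bound[OF yz])
    have "m = prepend y t \<or> (m, prepend y t) \<in> r" using term_bound(2)[OF yz] by simp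
    moreover have "prepend y t = m \<or> (prepend y t, m) \<in> r" by (rule m(2)[OF inX[OF yz(1) range]])
    ultimately have eq: "m = prepend y t" using r_asym by blast
    have "descends t m" using eq range finsupp_coeff(3)[OF yz(1)] by (auto simp: descends_def)
    then have "t = t0" using anti finsupp_coeff(2)[OF yz(1)] t0 desc by blast
    then show ?thesis using eq ty(3) prepend_inj by blast
  qed
  have lead: "lead ?f m"
    unfolding lead_def
  proof (intro conjI allI impI)
    have other: "(a t \<otimes>\<^bsub>A\<^esub> g t (fst m)) (snd m) = \<zero>\<^bsub>K\<^esub>" if t: "t \<in> {t. a t \<noteq> \<zero>\<^bsub>A\<^esub>} - {t0}" for t
    proof (rule ccontr)
      assume nz: "(a t \<otimes>\<^bsub>A\<^esub> g t (fst m)) (snd m) \<noteq> \<zero>\<^bsub>K\<^esub>"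
      have "t \<in> T" using t finsupp_lmodD(2)[OF a] by blast
      then obtain y z where "a t y \<noteq> \<zero>\<^bsub>K\<^esub>" "(y, z) \<in> path_factorizations E (snd m)" "g t (fst m) z \<noteq> \<zero>\<^bsub>K\<^esub>"
        using nz by (rule term_nonzero)
      then show False using only t by blast
    qed
    have at0: "a t0 \<noteq> \<zero>\<^bsub>A\<^esub>" using ty(1) by (auto simp: zero_A)
    have tc: "(a t \<otimes>\<^bsub>A\<^esub> g t (fst m)) (snd m) \<in> carrier K" if "a t \<noteq> \<zero>\<^bsub>A\<^esub>" for t
    proof -
      have "t \<in> T" using that finsupp_lmodD(2)[OF a] by blast
      then have "g t \<in> carrier V" using g by auto
      then show ?thesis by (intro coeff_closed mult_closed_A finsupp_coeff V_component)
    qed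
    \<comment> \<open>Only \<open>t0\<close> contributes at \<open>m\<close>, and within it only the
      factorization \<open>(y0, snd t0)\<close>; what remains is a product of two nonzero elements
      of the field.\<close>
    have "?f (fst m) (snd m) = (\<Oplus>\<^bsub>K\<^esub>t\<in>{t0}. (a t \<otimes>\<^bsub>A\<^esub> g t (fst m)) (snd m))"
      unfolding lin_ext_V[OF g a] using finsupp_lmodD(3)[OF a] at0 other tc
      by (intro K.add.finprod_mono_neutral_cong_right) auto
    also have "\<dots> = (a t0 \<otimes>\<^bsub>A\<^esub> g t0 (fst m)) (snd m)" using tc[OF at0] by simp
    also have "\<dots> = a t0 y0 \<otimes>\<^bsub>K\<^esub> g t0 (fst m) (snd t0)"
    proof (rule mult_A_single[OF finsupp_coeff(1) V_component[OF gt0]])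
      have "snd t0 \<in> paths E" using t0 T by (auto simp: nodes_def)
      then show "(y0, snd t0) \<in> path_factorizations E (snd m)"
        using y0 ty(2,3) by (simp add: path_factorizations_def prepend_def)
      fix y z assume yz: "(y, z) \<in> path_factorizations E (snd m)" "a t0 y \<noteq> \<zero>\<^bsub>K\<^esub>" "g t0 (fst m) z \<noteq> \<zero>\<^bsub>K\<^esub>"
      have y: "y = y0" using only[OF yz(2,1,3)] by simp
      moreover have "z = snd t0"
        using yz(1) ty(2,3) unfolding y by (intro prod_eqI) (auto simp: path_factorizations_def prepend_def)
      ultimately show "y = y0 \<and> z = snd t0" ..
    qed
    finally have "?f (fst m) (snd m) = a t0 y0 \<otimes>\<^bsub>K\<^esub> g t0 (fst m) (snd t0)" .
    moreover have "fst m = fst t0" by (simp add: ty(3) prepend_def)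
    ultimately show "?f (fst m) (snd m) \<noteq> \<zero>\<^bsub>K\<^esub>"
      using ty(1) lead_nonzero[OF bspec[OF lead_g t0]] coeff_closed[OF finsupp_coeff(1)] V_coeff[OF gt0]
      by (simp add: K.integral_iff)
    fix b x assume "?f b x \<noteq> \<zero>\<^bsub>K\<^esub>"
    then obtain t y z where tyz: "a t y \<noteq> \<zero>\<^bsub>K\<^esub>" "(y, z) \<in> path_factorizations E x" "g t b z \<noteq> \<zero>\<^bsub>K\<^esub>"
      by (rule lin_ext_nonzero)
    note bd = term_bound[OF tyz]
    show "(b, x) = m \<or> ((b, x), m) \<in> r"
      using bd(2) m(2)[OF inX[OF tyz(1) bd(1)]] transD[OF trans_r] by metis
  qed
  show thesis by (rule that[OF t0 desc lead])
qed

end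

section \<open>Leading nodes of a submodule\<close>

definition leads :: "('f \<Rightarrow> 'v \<times> 'e list \<Rightarrow> 'k) set \<Rightarrow> ('f \<times> 'v \<times> 'e list) set" where
  "leads N = {w. \<exists>f\<in>N. lead f w}"

lemma leads_in_nodes: "N \<subseteq> carrier V \<Longrightarrow> leads N \<subseteq> nodes"
  using lead_in_nodes unfolding leads_def by blast

lemma leads_descends:
  assumes N: "Module.submodule N A V" and w: "w \<in> leads N" and d: "descends w w'"
  shows "w' \<in> leads N"
proof -
  note ND = V.lmod_submoduleD[OF N]
  obtain f where f: "f \<in> N" "lead f w" using w by (auto simp: leads_def)
  obtain y where y: "y \<in> paths E" "path_range E y = fst (snd w)" "w' = prepend y w"
    using d unfolding descends_def by blast
  have "lead (path_elem y \<odot>\<^bsub>V\<^esub> f) w'"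
    unfolding y(3) using f ND(1) y by (intro lead_smult) auto
  moreover have "path_elem y \<odot>\<^bsub>V\<^esub> f \<in> N" by (rule ND(4)[OF path_elem_closed[OF y(1)] f(1)])
  ultimately show ?thesis unfolding leads_def by blast
qed

lemma submodule_lin_ext_image:
  assumes "g \<in> T \<rightarrow> carrier V"
  shows "Module.submodule (lin_ext A V g ` carrier (finsupp_lmod A T)) A V"
proof -
  have F: "left_module A (finsupp_lmod A T)" by (rule left_module_finsupp) (rule ring_A)
  show ?thesis
    by (rule submodule_hom_image[OF F left_module_V lin_ext_hom[OF left_module_V assms]])
      (rule left_module.submodule_carrier[OF F])
qed

lemma lin_ext_image_generator:
  assumes "g \<in> T \<rightarrow> carrier V" "t \<in> T"
  shows "g t \<in> lin_ext A V g ` carrier (finsupp_lmod A T)"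
  using lin_ext_single[OF left_module_V assms] by (metis (no_types, lifting) imageI)

text \<open>The minimal leading nodes may at this point be infinite in number. Elements of
  \<open>N\<close> leading at them generate \<open>N\<close> by division; the finite set
  \<open>S\<close> uses finitely many of them, so these already generate \<open>N\<close>, and
  without cancellation they account for all leading nodes.\<close>

lemma finitely_generated_leads:
  assumes N: "Module.submodule N A V" and S: "finite S" "S \<subseteq> N"
    and gen: "\<And>U. \<lbrakk>Module.submodule U A V; S \<subseteq> U\<rbrakk> \<Longrightarrow> N \<subseteq> U"
  obtains T where "finite T" "T \<subseteq> leads N" "\<And>w. w \<in> leads N \<Longrightarrow> \<exists>t\<in>T. descends t w"
proof -
  note ND = V.lmod_submoduleD[OF N]
  define T where "T = minimal (leads N)"
  have TL: "T \<subseteq> leads N" by (auto simp: T_def minimal_def)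
  have Tn: "T \<subseteq> nodes" using TL leads_in_nodes[OF ND(1)] by blast
  have "\<forall>t\<in>T. \<exists>f\<in>N. lead f t" using TL by (auto simp: leads_def)
  then obtain f where f: "\<And>t. t \<in> T \<Longrightarrow> f t \<in> N" "\<And>t. t \<in> T \<Longrightarrow> lead (f t) t" by metis
  \<comment> \<open>The trivial path at the source of \<open>t\<close> retains the leading term and
    deletes all terms starting elsewhere, which yields homogeneity.\<close>
  define g where "g t = path_elem (fst (snd t), []) \<odot>\<^bsub>V\<^esub> f t" for t
  have gN: "g t \<in> N" if "t \<in> T" for t
    unfolding g_def using that Tn f(1) by (intro ND(4) path_elem_closed trivial_path) auto
  have gV: "g \<in> T \<rightarrow> carrier V" using gN ND(1) by auto
  have gl: "lead (g t) t" if t: "t \<in> T" for t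
  proof -
    have "t \<in> nodes" "f t \<in> carrier V" using t Tn f(1)[OF t] ND(1) by blast+
    then have "lead (g t) (prepend (fst (snd t), []) t)"
      unfolding g_def by (intro lead_smult trivial_path f(2) t) (auto simp: path_range_Nil)
    then show ?thesis by (simp add: prepend_Nil)
  qed
  have gh: "fst x = fst (snd t)" if t: "t \<in> T" and nz: "g t b x \<noteq> \<zero>\<^bsub>K\<^esub>" for t b x
  proof -
    have "t \<in> nodes" "f t \<in> carrier V" using t Tn f(1)[OF t] ND(1) by blast+
    then obtain z where "(b, x) = prepend (fst (snd t), []) (b, z)"
      using path_elem_smult_nonzero[OF _ trivial_path nz[unfolded g_def]] by blast
    then show ?thesis by (simp add: prepend_def)
  qed
  \<comment> \<open>Division by the \<open>g t\<close>: a leading node of \<open>N\<close> has the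
    form \<open>prepend y t\<close> with \<open>t\<close> minimal, and the product of
    \<open>y\<close> with \<open>g t\<close> realizes it inside both \<open>N\<close> and the
    image.\<close>
  have NU: "N \<subseteq> lin_ext A V g ` carrier (finsupp_lmod A T)" (is "N \<subseteq> ?U")
  proof (rule subset_by_lead)
    note UD = V.lmod_submoduleD[OF submodule_lin_ext_image[OF gV]]
    show "\<zero>\<^bsub>V\<^esub> \<in> ?U" by (rule UD(2))
    show "h \<oplus>\<^bsub>V\<^esub> k \<in> ?U" if "h \<in> ?U" "k \<in> ?U" for h k using that by (rule UD(3))
    show "(k \<odot>\<^bsub>A\<^esub> \<one>\<^bsub>A\<^esub>) \<odot>\<^bsub>V\<^esub> h \<in> ?U" if "k \<in> carrier K" "h \<in> ?U" for k h
      by (rule UD(4)[OF scalar_closed[OF that(1)] that(2)])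
    show "N \<subseteq> carrier V" by (rule ND(1))
    show "h \<oplus>\<^bsub>V\<^esub> k \<in> N" if "h \<in> N" "k \<in> N" for h k using that by (rule ND(3))
    show "(k \<odot>\<^bsub>A\<^esub> \<one>\<^bsub>A\<^esub>) \<odot>\<^bsub>V\<^esub> h \<in> N" if "k \<in> carrier K" "h \<in> N" for k h
      by (rule ND(4)[OF scalar_closed[OF that(1)] that(2)])
    fix h w assume "h \<in> N" "lead h w"
    then have "w \<in> leads N" by (auto simp: leads_def)
    then obtain t where t: "t \<in> T" "descends t w"
      unfolding T_def by (rule minimal_exists[OF leads_in_nodes[OF ND(1)]])
    then obtain y where y: "y \<in> paths E" "path_range E y = fst (snd t)" "w = prepend y t"
      unfolding descends_def by blast
    have "path_elem y \<odot>\<^bsub>V\<^esub> g t \<in> ?U"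
      by (rule UD(4)[OF path_elem_closed[OF y(1)] lin_ext_image_generator[OF gV t(1)]])
    moreover have "path_elem y \<odot>\<^bsub>V\<^esub> g t \<in> N"
      by (rule ND(4)[OF path_elem_closed[OF y(1)] gN[OF t(1)]])
    moreover have "lead (path_elem y \<odot>\<^bsub>V\<^esub> g t) w"
      unfolding y(3) using gV t(1) y by (intro lead_smult gl) auto
    ultimately show "\<exists>u\<in>?U \<inter> N. lead u w" by blast
  qed
  have "\<forall>s\<in>S. \<exists>a. a \<in> carrier (finsupp_lmod A T) \<and> lin_ext A V g a = s"
    using S(2) NU by blast
  then obtain c where c: "\<And>s. s \<in> S \<Longrightarrow> c s \<in> carrier (finsupp_lmod A T)"
    "\<And>s. s \<in> S \<Longrightarrow> lin_ext A V g (c s) = s" by metis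
  \<comment> \<open>The indices that occur in chosen expressions of the elements of
    \<open>S\<close>: finitely many, each expression having finite support.\<close>
  define T0 where "T0 = (\<Union>s\<in>S. {t. c s t \<noteq> \<zero>\<^bsub>A\<^esub>})"
  have fin: "finite T0" unfolding T0_def using S(1) finsupp_lmodD(3)[OF c(1)] by blast
  have T0T: "T0 \<subseteq> T"
  proof
    fix t assume "t \<in> T0"
    then obtain s where "s \<in> S" "c s t \<noteq> \<zero>\<^bsub>A\<^esub>" by (auto simp: T0_def)
    then show "t \<in> T" using finsupp_lmodD(2)[OF c(1)] by blast
  qed
  have gV0: "g \<in> T0 \<rightarrow> carrier V" using gV T0T by blast
  have c0: "c s \<in> carrier (finsupp_lmod A T0)" if "s \<in> S" for s
    using c(1)[OF that] that by (auto simp: finsupp_lmod_def T0_def)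
  have NU0: "N \<subseteq> lin_ext A V g ` carrier (finsupp_lmod A T0)"
  proof (rule gen[OF submodule_lin_ext_image[OF gV0]], rule subsetI)
    fix s assume "s \<in> S"
    then show "s \<in> lin_ext A V g ` carrier (finsupp_lmod A T0)"
      using c(2) c0 by (metis imageI)
  qed
  show thesis
  proof (rule that[OF fin])
    show "T0 \<subseteq> leads N" using T0T TL by blast
    fix w assume "w \<in> leads N"
    then obtain h where h: "h \<in> N" "lead h w" by (auto simp: leads_def)
    then obtain a where a: "a \<in> carrier (finsupp_lmod A T0)" "h = lin_ext A V g a" using NU0 by blast
    have ctx: "T0 \<subseteq> nodes" "\<forall>t\<in>T0. lead (g t) t"
      "\<forall>t\<in>T0. \<forall>b x. g t b x \<noteq> \<zero>\<^bsub>K\<^esub> \<longrightarrow> fst x = fst (snd t)"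
      using T0T Tn gl gh by blast+
    \<comment> \<open>A nonzero coefficient is needed to exhibit a pair \<open>t\<close>,
      \<open>y\<close> that composes, without which the combination could vanish. The leading node
      then found below some \<open>t'\<close> is \<open>w\<close>, by uniqueness.\<close>
    have "lin_ext A V g a (fst w) (snd w) \<noteq> \<zero>\<^bsub>K\<^esub>" using lead_nonzero[OF h(2)] a(2) by simp
    then obtain t y z where "t \<in> T0" and tyz: "a t y \<noteq> \<zero>\<^bsub>K\<^esub>"
        "(y, z) \<in> path_factorizations E (snd w)" "g t (fst w) z \<noteq> \<zero>\<^bsub>K\<^esub>"
      by (rule lin_ext_nonzero[OF ctx(1) gV0 ctx(2,3) a(1)])
    have range: "path_range E y = fst (snd t)"
      by (rule term_bound(1)[OF ctx(1) gV0 ctx(2,3) a(1) tyz])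
    have anti: "\<forall>t\<in>T0. \<forall>t'\<in>T0. \<forall>w. descends t w \<longrightarrow> descends t' w \<longrightarrow> t = t'"
      using minimal_antichain T0T unfolding T_def by blast
    obtain t' w' where "t' \<in> T0" "descends t' w'" "lead (lin_ext A V g a) w'"
      by (rule lead_lin_ext[OF ctx(1) gV0 ctx(2,3) a(1) anti tyz(1) range])
    then show "\<exists>t\<in>T0. descends t w" using lead_unique[OF h(2)] a(2) by blast
  qed
qed

section \<open>The projective submodule and its codimension\<close>

lemma projective_submodule_of_finite_codimension:
  fixes L :: "('v \<times> 'e list \<Rightarrow> 'k, 'm) module"
  assumes L: "left_module A L" and \<phi>: "\<phi> \<in> module_hom A V L" and surj: "\<phi> ` carrier V = carrier L"
    and S: "finite S" "S \<subseteq> {c \<in> carrier V. \<phi> c = \<zero>\<^bsub>L\<^esub>}"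
    and gen: "\<And>U. \<lbrakk>Module.submodule U A V; S \<subseteq> U\<rbrakk> \<Longrightarrow> {c \<in> carrier V. \<phi> c = \<zero>\<^bsub>L\<^esub>} \<subseteq> U"
  shows "\<exists>Q. Module.submodule Q A L \<and> projective_lmod A (L\<lparr>carrier := Q\<rparr>) \<and>
    finite_dimensional K (restrict_scalars A (quotient_lmod L Q))"
proof -
  interpret L: left_module A L by fact
  define N where "N = {c \<in> carrier V. \<phi> c = \<zero>\<^bsub>L\<^esub>}"
  have N: "Module.submodule N A V"
    using submodule_hom_vimage[OF left_module_V L \<phi> L.submodule_zero] by (simp add: N_def)
  note ND = V.lmod_submoduleD[OF N]
  obtain T where T: "finite T" "T \<subseteq> leads N" "\<And>w. w \<in> leads N \<Longrightarrow> \<exists>t\<in>T. descends t w"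
    using finitely_generated_leads[OF N S(1)] S(2) gen unfolding N_def by blast
  define W0 where "W0 = {w \<in> nodes. \<forall>w'. descends w w' \<longrightarrow> w' \<notin> leads N}"
  have W0n: "W0 \<subseteq> nodes" by (auto simp: W0_def)
  have W0d: "w' \<in> W0" if "w \<in> W0" "descends w w'" for w w'
    using that descends_trans descends_in_nodes unfolding W0_def by blast
  define VW where "VW = {c \<in> carrier V. \<forall>b x. c b x \<noteq> \<zero>\<^bsub>K\<^esub> \<longrightarrow> (b, x) \<in> W0}"
  \<comment> \<open>Ring elements move each node to combinations of its descendants, so the span of
    \<open>W0\<close> is a submodule because \<open>W0\<close> is closed under descent.\<close>
  have VW: "Module.submodule VW A V"
  proof (rule V.lmod_submoduleI)
    show "VW \<subseteq> carrier V" by (auto simp: VW_def)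
    show "\<zero>\<^bsub>V\<^esub> \<in> VW" unfolding VW_def using V.zero_closed by (simp add: zero_V del: split_paired_All)
    show "c \<oplus>\<^bsub>V\<^esub> d \<in> VW" if c: "c \<in> VW" and d: "d \<in> VW" for c d
    proof -
      have "c b x \<noteq> \<zero>\<^bsub>K\<^esub> \<or> d b x \<noteq> \<zero>\<^bsub>K\<^esub>" if "(c \<oplus>\<^bsub>V\<^esub> d) b x \<noteq> \<zero>\<^bsub>K\<^esub>" for b x
        using that by (auto simp: add_V)
      then show ?thesis using c d V.add.m_closed unfolding VW_def by blast
    qed
    show "f \<odot>\<^bsub>V\<^esub> c \<in> VW" if f: "f \<in> carrier A" and c: "c \<in> VW" for f c
    proof -
      have cV: "c \<in> carrier V" using c by (simp add: VW_def)
      have "(b, x) \<in> W0" if nz: "(f \<odot>\<^bsub>V\<^esub> c) b x \<noteq> \<zero>\<^bsub>K\<^esub>" for b x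
      proof -
        obtain y z where yz: "(y, z) \<in> path_factorizations E x" "c b z \<noteq> \<zero>\<^bsub>K\<^esub>"
          using mult_A_nonzero[OF f V_component[OF cV] nz[unfolded smult_V]] by blast
        then have "(b, z) \<in> W0" using c unfolding VW_def by blast
        moreover have "descends (b, z) (b, x)"
          using yz(1) by (auto simp: path_factorizations_def descends_def prepend_def)
        ultimately show ?thesis by (rule W0d)
      qed
      then show ?thesis using f cV V.smult_closed unfolding VW_def by blast
    qed
  qed
  note VWD = V.lmod_submoduleD[OF VW]
  have mVW: "monomial w \<in> VW" if "w \<in> W0" for w
  proof -
    have "monomial w \<in> carrier V" using that W0n by (intro monomial_closed) auto
    moreover have "(b, x) \<in> W0" if "monomial w b x \<noteq> \<zero>\<^bsub>K\<^esub>" for b x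
      using that \<open>w \<in> W0\<close> by (simp add: monomial_nonzero)
    ultimately show ?thesis unfolding VW_def by blast
  qed
  define W where "W = minimal W0"
  have WW0: "W \<subseteq> W0" by (auto simp: W_def minimal_def)
  have Wn: "W \<subseteq> nodes" using WW0 W0n by (rule subset_trans)
  have mW: "monomial \<in> W \<rightarrow> carrier V" using Wn monomial_closed by blast
  have "fst x = fst (snd t)" if "monomial t b x \<noteq> \<zero>\<^bsub>K\<^esub>" for t b x
    using that by (simp add: monomial_nonzero)
  then have mh: "\<forall>t\<in>W. \<forall>b x. monomial t b x \<noteq> \<zero>\<^bsub>K\<^esub> \<longrightarrow> fst x = fst (snd t)" by blast
  have ml: "\<forall>t\<in>W. lead (monomial t) t" using lead_monomial by blast
  have anti: "\<forall>t\<in>W. \<forall>t'\<in>W. \<forall>w. descends t w \<longrightarrow> descends t' w \<longrightarrow> t = t'"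
    using minimal_antichain unfolding W_def by blast
  \<comment> \<open>Each node of \<open>W0\<close> lies below a minimal one, so its monomial is a
    path times a monomial from \<open>W\<close>, and division gives generation.\<close>
  have VWU: "VW \<subseteq> lin_ext A V monomial ` carrier (finsupp_lmod A W)" (is "VW \<subseteq> ?U")
  proof (rule subset_by_lead)
    note UD = V.lmod_submoduleD[OF submodule_lin_ext_image[OF mW]]
    show "\<zero>\<^bsub>V\<^esub> \<in> ?U" by (rule UD(2))
    show "h \<oplus>\<^bsub>V\<^esub> k \<in> ?U" if "h \<in> ?U" "k \<in> ?U" for h k using that by (rule UD(3))
    show "(k \<odot>\<^bsub>A\<^esub> \<one>\<^bsub>A\<^esub>) \<odot>\<^bsub>V\<^esub> h \<in> ?U" if "k \<in> carrier K" "h \<in> ?U" for k h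
      by (rule UD(4)[OF scalar_closed[OF that(1)] that(2)])
    show "VW \<subseteq> carrier V" by (rule VWD(1))
    show "h \<oplus>\<^bsub>V\<^esub> k \<in> VW" if "h \<in> VW" "k \<in> VW" for h k using that by (rule VWD(3))
    show "(k \<odot>\<^bsub>A\<^esub> \<one>\<^bsub>A\<^esub>) \<odot>\<^bsub>V\<^esub> h \<in> VW" if "k \<in> carrier K" "h \<in> VW" for k h
      by (rule VWD(4)[OF scalar_closed[OF that(1)] that(2)])
    fix h w assume h: "h \<in> VW" and l: "lead h w"
    have w: "(fst w, snd w) \<in> W0" using h lead_nonzero[OF l] unfolding VW_def by blast
    then have w: "w \<in> W0" by simp
    then obtain t where t: "t \<in> W" "descends t w" unfolding W_def by (rule minimal_exists[OF W0n])
    then obtain y where y: "y \<in> paths E" "path_range E y = fst (snd t)" "w = prepend y t"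
      unfolding descends_def by blast
    have "path_elem y \<odot>\<^bsub>V\<^esub> monomial t \<in> ?U"
      by (rule UD(4)[OF path_elem_closed[OF y(1)] lin_ext_image_generator[OF mW t(1)]])
    then have "monomial w \<in> ?U"
      unfolding y(3) path_elem_monomial[OF subsetD[OF Wn t(1)] y(1,2)] .
    then show "\<exists>u\<in>?U \<inter> VW. lead u w" using mVW[OF w] lead_monomial by blast
  qed
  define Q where "Q = \<phi> ` VW"
  have Q: "Module.submodule Q A L" unfolding Q_def by (rule submodule_hom_image[OF left_module_V L \<phi> VW])
  define q where "q w = \<phi> (monomial w)" for w
  have qQ: "q \<in> W \<rightarrow> Q" using mVW WW0 by (auto simp: q_def Q_def)
  have lin_q: "lin_ext A (L\<lparr>carrier := Q\<rparr>) q a = \<phi> (lin_ext A V monomial a)"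
    if a: "a \<in> carrier (finsupp_lmod A W)" for a
  proof -
    have "lin_ext A (L\<lparr>carrier := Q\<rparr>) q a = lin_ext A L q a"
      by (rule lin_ext_submodule[OF L Q qQ a])
    also have "\<dots> = \<phi> (lin_ext A V monomial a)"
      by (rule lin_ext_natural[OF left_module_V L \<phi> mW a, symmetric]) (simp add: q_def)
    finally show ?thesis .
  qed
  \<comment> \<open>The idempotent for \<open>w\<close> is the trivial path at its source, which
    fixes the monomial of \<open>w\<close>. Ring elements whose product with this idempotent is zero
    annihilate the monomial, and \<open>indep\<close> requires that no other relations
    exist.\<close>
  have proj: "projective_lmod A (L\<lparr>carrier := Q\<rparr>)"
  proof (rule projective_lmodI[where I = W and q = q and e = "\<lambda>w. path_elem (fst (snd w), [])"])
    show "left_module A (L\<lparr>carrier := Q\<rparr>)" by (rule L.left_module_submodule[OF Q])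
    show "q \<in> W \<rightarrow> carrier (L\<lparr>carrier := Q\<rparr>)" using qQ by simp
    show "(\<lambda>w. path_elem (fst (snd w), [])) \<in> W \<rightarrow> carrier A"
      using Wn by (intro Pi_I path_elem_closed trivial_path) (rule subsetD)
    show "path_elem (fst (snd w), []) \<odot>\<^bsub>L\<lparr>carrier := Q\<rparr>\<^esub> q w = q w" if "w \<in> W" for w
    proof -
      have w: "w \<in> nodes" using that Wn by (rule rev_subsetD)
      have "path_elem (fst (snd w), []) \<odot>\<^bsub>L\<^esub> q w = \<phi> (path_elem (fst (snd w), []) \<odot>\<^bsub>V\<^esub> monomial w)"
        unfolding q_def
        by (rule module_hom_smult[OF \<phi> path_elem_closed[OF trivial_path[OF w]] monomial_closed[OF w], symmetric])
      also have "\<dots> = q w"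
        using path_elem_monomial[OF w trivial_path[OF w]] by (simp add: path_range_Nil prepend_Nil q_def)
      finally show ?thesis by simp
    qed
    show "carrier (L\<lparr>carrier := Q\<rparr>) \<subseteq> lin_ext A (L\<lparr>carrier := Q\<rparr>) q ` carrier (finsupp_lmod A W)"
    proof
      fix x assume "x \<in> carrier (L\<lparr>carrier := Q\<rparr>)"
      then obtain c where c: "c \<in> VW" "x = \<phi> c" by (auto simp: Q_def)
      from c(1) VWU have "c \<in> ?U" by (rule rev_subsetD)
      then obtain a where "a \<in> carrier (finsupp_lmod A W)" "c = lin_ext A V monomial a" by (elim imageE)
      then show "x \<in> lin_ext A (L\<lparr>carrier := Q\<rparr>) q ` carrier (finsupp_lmod A W)"
        using lin_q c(2) by (intro image_eqI[of _ _ a]) auto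
    qed
    fix a w assume a: "a \<in> carrier (finsupp_lmod A W)"
      and z: "lin_ext A (L\<lparr>carrier := Q\<rparr>) q a = \<zero>\<^bsub>L\<lparr>carrier := Q\<rparr>\<^esub>" and w: "w \<in> W"
    let ?c = "lin_ext A V monomial a"
    have "?c \<in> carrier V" using module_hom_closed[OF lin_ext_hom[OF left_module_V mW]] a by auto
    then have cN: "?c \<in> N" using z lin_q[OF a] by (simp add: N_def)
    \<comment> \<open>One contradiction settles two points, that the sum over \<open>W\<close> is
      direct and that \<open>\<phi>\<close> is injective on it: a nonzero product would give
      \<open>?c\<close>, an element of \<open>N\<close>, a leading node below a member of
      \<open>W\<close>, whereas nothing below \<open>W0\<close> leads an element of
      \<open>N\<close>.\<close>
    show "a w \<otimes>\<^bsub>A\<^esub> path_elem (fst (snd w), []) = \<zero>\<^bsub>A\<^esub>"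
    proof (rule ccontr)
      assume "a w \<otimes>\<^bsub>A\<^esub> path_elem (fst (snd w), []) \<noteq> \<zero>\<^bsub>A\<^esub>"
      then obtain x where x: "(a w \<otimes>\<^bsub>A\<^esub> path_elem (fst (snd w), [])) x \<noteq> \<zero>\<^bsub>K\<^esub>"
        by (metis ext zero_A)
      have "path_elem (fst (snd w), []) \<in> carrier A"
        using w Wn by (intro path_elem_closed trivial_path) auto
      then obtain y z where yz: "(y, z) \<in> path_factorizations E x" "a w y \<noteq> \<zero>\<^bsub>K\<^esub>"
          "path_elem (fst (snd w), []) z \<noteq> \<zero>\<^bsub>K\<^esub>"
        using mult_A_nonzero[OF finsupp_lmodD(1)[OF a] _ x] by blast
      have "path_range E y = fst (snd w)"
        using yz(1,3) by (auto simp: path_elem_nonzero path_factorizations_def)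
      then obtain t w' where t: "t \<in> W" "descends t w'" "lead ?c w'"
        by (rule lead_lin_ext[OF Wn mW ml mh a anti yz(2)])
      then have "w' \<in> leads N" using cN by (auto simp: leads_def)
      then show False using t(1,2) WW0 unfolding W0_def by blast
    qed
  qed
  let ?X = "quotient_lmod L Q"
  let ?Y = "restrict_scalars A ?X"
  have X: "left_module A ?X" by (rule L.quotient_lmod(1)[OF Q])
  interpret Y: vectorspace K ?Y by (rule vectorspace_restrict_scalars[OF X])
  define \<psi> where "\<psi> c = Q +>\<^bsub>L\<^esub> \<phi> c" for c
  have \<phi>c: "\<phi> c \<in> carrier L" if "c \<in> carrier V" for c using module_hom_closed[OF \<phi>] that by auto
  note qh = L.quotient_map_hom[OF Q]
  have car: "carrier ?Y = carrier ?X" "add ?Y = add ?X" "zero ?Y = zero ?X"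
    by (simp_all add: restrict_scalars_def)
  have \<psi>c: "\<psi> c \<in> carrier ?Y" if "c \<in> carrier V" for c
    using \<phi>c[OF that] qh(2) unfolding \<psi>_def car by blast
  have \<psi>add: "\<psi> (c \<oplus>\<^bsub>V\<^esub> d) = \<psi> c \<oplus>\<^bsub>?Y\<^esub> \<psi> d" if "c \<in> carrier V" "d \<in> carrier V" for c d
    using that \<phi>c by (simp add: \<psi>_def car module_hom_add[OF \<phi>] module_hom_add[OF qh(1)])
  have \<psi>scale: "\<psi> ((k \<odot>\<^bsub>A\<^esub> \<one>\<^bsub>A\<^esub>) \<odot>\<^bsub>V\<^esub> c) = k \<odot>\<^bsub>?Y\<^esub> \<psi> c" if "k \<in> carrier K" "c \<in> carrier V" for k c
    using that \<phi>c scalar_closed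
    by (simp add: \<psi>_def restrict_scalars_def module_hom_smult[OF \<phi>] module_hom_smult[OF qh(1)])
  \<comment> \<open>The exceptional nodes. Overlap with \<open>leads N\<close> is harmless
    (\<open>T\<close> itself lies in \<open>Z\<close>); what counts is that \<open>Z\<close> is
    finite and catches every node outside \<open>leads N\<close> and \<open>W0\<close>.\<close>
  define Z where "Z = {s \<in> nodes. \<exists>t\<in>T. descends s t}"
  define G where "G = (\<lambda>s. \<psi> (monomial s)) ` Z"
  have "Z \<subseteq> (\<Union>t\<in>T. {s. descends s t})" by (auto simp: Z_def)
  then have "finite Z" by (rule finite_subset) (use T(1) finite_ancestors in auto)
  then have Gf: "finite G" by (simp add: G_def)
  have Gc: "G \<subseteq> carrier ?Y" unfolding G_def Z_def using \<psi>c monomial_closed by blast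
  have sp: "LinearCombinations.submodule K (Y.span G) ?Y" by (rule Y.span_is_submodule[OF Gc])
  interpret sp: LinearCombinations.submodule K "Y.span G" ?Y by (rule sp)
  have zG: "\<zero>\<^bsub>?Y\<^esub> \<in> Y.span G" by (rule sp.zero_closed)
  define U where "U = {c \<in> carrier V. \<psi> c \<in> Y.span G}"
  \<comment> \<open>Serves two kinds of elements at once: those of \<open>N\<close>, which
    \<open>\<phi>\<close> sends to zero, and those of \<open>VW\<close>, which it sends into
    \<open>Q\<close>.\<close>
  have zero_in: "c \<in> U" if "c \<in> carrier V" "\<phi> c \<in> Q" for c
  proof -
    have "\<psi> c = \<zero>\<^bsub>?Y\<^esub>" unfolding \<psi>_def car by (rule qh(3)[OF that(2)])
    then show ?thesis using that(1) zG by (simp add: U_def)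
  qed
  have zQ: "\<zero>\<^bsub>L\<^esub> \<in> Q" by (rule L.lmod_submoduleD(2)[OF Q])
  \<comment> \<open>Division in the whole of \<open>V\<close>: it suffices that every node is the
    leading node of some element whose class lies in the span of \<open>G\<close>.\<close>
  have "carrier V \<subseteq> U"
  proof (rule subset_by_lead)
    show "\<zero>\<^bsub>V\<^esub> \<in> U"
      using zQ left_module_hom_zero[OF left_module_V L \<phi>] by (intro zero_in) auto
    show "h \<oplus>\<^bsub>V\<^esub> k \<in> U" if "h \<in> U" "k \<in> U" for h k
      using that sp.m_closed by (auto simp: U_def \<psi>add)
    show "(k \<odot>\<^bsub>A\<^esub> \<one>\<^bsub>A\<^esub>) \<odot>\<^bsub>V\<^esub> h \<in> U" if "k \<in> carrier K" "h \<in> U" for k h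
      using that sp.smult_closed scalar_closed by (auto simp: U_def \<psi>scale)
    show "(k \<odot>\<^bsub>A\<^esub> \<one>\<^bsub>A\<^esub>) \<odot>\<^bsub>V\<^esub> h \<in> carrier V" if "k \<in> carrier K" "h \<in> carrier V" for k h
      using that scalar_closed by simp
    fix h w assume h: "h \<in> carrier V" "lead h w"
    have w: "w \<in> nodes" by (rule lead_in_nodes[OF h])
    consider "w \<in> leads N" | "w \<in> W0" | "w \<notin> leads N" "w \<notin> W0" by blast
    then show "\<exists>u\<in>U \<inter> carrier V. lead u w"
    proof cases
      case 1
      then obtain u where u: "u \<in> N" "lead u w" by (auto simp: leads_def)
      then have "u \<in> carrier V" "\<phi> u \<in> Q" using zQ by (auto simp: N_def)
      then show ?thesis using zero_in u(2) by blast
    next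
      case 2
      then have "monomial w \<in> VW" by (rule mVW)
      then have "monomial w \<in> carrier V" "\<phi> (monomial w) \<in> Q" using VWD(1) by (auto simp: Q_def)
      then show ?thesis using zero_in lead_monomial by blast
    next
      case 3
      then obtain w' where w': "descends w w'" "w' \<in> leads N" using w by (auto simp: W0_def)
      then obtain t where t: "t \<in> T" "descends t w'" using T(3) by blast
      \<comment> \<open>Both \<open>w\<close> and \<open>t\<close> are ancestors of
        \<open>w'\<close>, hence comparable. If \<open>w\<close> descended from \<open>t\<close> it
        would be a leading node of \<open>N\<close>, so \<open>w\<close> is an ancestor of
        \<open>t\<close>.\<close>
      have "\<not> descends t w"
        using leads_descends[OF N] t(1) T(2) 3(1) by blast
      then have "descends w t" using descends_linear[OF w'(1) t(2)] by blast
      then have "w \<in> Z" using w t(1) by (auto simp: Z_def)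
      then have "\<psi> (monomial w) \<in> Y.span G"
        using Y.in_own_span[OF Gc] by (auto simp: G_def)
      then have "monomial w \<in> U" using monomial_closed[OF w] by (simp add: U_def)
      then show ?thesis using monomial_closed[OF w] lead_monomial by blast
    qed
  qed auto
  moreover have "carrier ?Y = \<psi> ` carrier V"
    unfolding car qh(2)[symmetric] surj[symmetric] \<psi>_def image_image ..
  ultimately have "carrier ?Y \<subseteq> Y.span G" by (auto simp: U_def)
  moreover have "Y.span G \<subseteq> carrier ?Y" by (rule Y.span_is_subset2[OF Gc])
  ultimately have "Y.fin_dim" unfolding Y.fin_dim_def using Gf Gc by blast
  then have "finite_dimensional K ?Y" unfolding finite_dimensional_def using Y.vectorspace_axioms by blast
  then show ?thesis using Q proj by blast
qed

end

theorem theorem3p14: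
  fixes K :: "('k, 'x) ring_scheme"
    and E :: "('v, 'e) pre_digraph"
    and L :: "('v \<times> 'e list \<Rightarrow> 'k, 'm) module"
  assumes "field K"
    and "fin_digraph E"
    and "left_module (path_algebra K E) L"
    and "finitely_related TYPE('f) (path_algebra K E) L"
  shows "\<exists>Q. Module.submodule Q (path_algebra K E) L \<and>
             projective_lmod (path_algebra K E) (L\<lparr>carrier := Q\<rparr>) \<and>
             finite_dimensional K (restrict_scalars (path_algebra K E) (quotient_lmod L Q))"
proof -
  interpret fin_digraph E by fact
  show ?thesis
  proof (rule finitely_related_coordinates[OF assms(4)])
    fix B :: "'f set" and \<phi> S
    let ?V = "finsupp_lmod (path_algebra K E) B"
    assume \<phi>: "\<phi> \<in> module_hom (path_algebra K E) ?V L" "\<phi> ` carrier ?V = carrier L"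
        "finite S" "S \<subseteq> {c \<in> carrier ?V. \<phi> c = \<zero>\<^bsub>L\<^esub>}"
      and gen: "\<And>U. \<lbrakk>Module.submodule U (path_algebra K E) ?V; S \<subseteq> U\<rbrakk> \<Longrightarrow>
        {c \<in> carrier ?V. \<phi> c = \<zero>\<^bsub>L\<^esub>} \<subseteq> U"
    show ?thesis
    proof (rule monomial_order)
      fix r :: "('f \<times> 'v \<times> 'e list) rel"
      assume r: "wf r" "trans r"
        "\<And>w w'. \<lbrakk>snd w \<in> paths E; snd w' \<in> paths E; w \<noteq> w'\<rbrakk> \<Longrightarrow> (w, w') \<in> r \<or> (w', w) \<in> r"
        "\<And>w w' y. \<lbrakk>(w, w') \<in> r; path_range E y = fst (snd w); path_range E y = fst (snd w')\<rbrakk> \<Longrightarrow>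
          (prepend y w, prepend y w') \<in> r"
      have "path_free_module K E r"
        by (intro path_free_module.intro path_algebra_over.intro path_free_module_axioms.intro assms(1,2))
          (fact r)+
      from path_free_module.projective_submodule_of_finite_codimension[OF this assms(3) \<phi>]
      show ?thesis using gen .
    qed
  qed
qed

end
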